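(* Let $n\ge 6$ be an integer, let $\alpha,\beta,\gamma\in\mathbb{Q}$, and let $a_1,\dots,a_{n-3}\in\mathbb{Z}$ be such that $$-2a_3\ne\binom n3\left(-\frac{2a_1}{n}\right)^3+\binom{n-1}{2}\left(-\frac{2a_1}{n}\right)^2a_1+(n-2)\left(-\frac{2a_1}{n}\right)a_2.$$ Let $G_0,G_1,G_2\in\mathbb{Q}[X]$ be given by one of the following: (i) $G_0(X)=X^n+a_1X^{n-1}+\cdots+a_{n-3}X^3-\alpha$, $\ G_1(X)=X^2-\beta$, $\ G_2(X)=X-\gamma$; (ii) $G_0(X)=X^n+a_1X^{n-1}+\cdots+a_{n-3}X^3-\alpha X$, $\ G_1(X)=X^2-\beta X$, $\ G_2(X)=1$. Let $a,b$ be independent indeterminates and put $f(X)=G_0(X)+aG_1(X)+bG_2(X)$. If $f$ is irreducible over $\mathbb{Q}(a,b)$, then the Galois group of $f$ over $\mathbb{C}(a,b)$ is $S_n$.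
   Context: The Galois group of $f$ over $\mathbb{C}(a,b)$ is that of its splitting field over $\mathbb{C}(a,b)$, acting on the $n$ roots of $f$. *)

theory Defs
  imports "HOL-Algebra.Algebra" "HOL-Algebra.Algebraic_Closure_Type"
    "HOL-Computational_Algebra.Computational_Algebra"
begin

text \<open>The field \<open>k(a, b)\<close> of rational functions, as the fraction field of \<open>k[a][b]\<close>:
  \<open>a\<close> is the variable of the inner polynomial ring and \<open>b\<close> that of the outer one.\<close>

type_synonym 'k ratfun2 = "'k poly poly fract"

definition ratfun2_const :: "'k::field \<Rightarrow> 'k ratfun2" where
  "ratfun2_const c = to_fract [:[:c:]:]"

definition indet_a :: "'k::field ratfun2" where
  "indet_a = to_fract [:[:0, 1:]:]"

definition indet_b :: "'k::field ratfun2" where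
  "indet_b = to_fract [:0, 1:]"

definition family2 :: "'k::field poly \<Rightarrow> 'k poly \<Rightarrow> 'k poly \<Rightarrow> 'k ratfun2 poly" where
  "family2 G0 G1 G2 =
     map_poly ratfun2_const G0
     + smult indet_a (map_poly ratfun2_const G1)
     + smult indet_b (map_poly ratfun2_const G2)"

definition ac_roots :: "'k::field poly \<Rightarrow> 'k alg_closure set" where
  "ac_roots p = {x. poly (map_poly to_ac p) x = 0}"

definition splitting_field :: "'k::field poly \<Rightarrow> 'k alg_closure set" where
  "splitting_field p = generate_field ring_of_type_algebra (range to_ac \<union> ac_roots p)"

text \<open>Automorphisms are represented as functions extensional on the splitting field, as in
  \<^const>\<open>BijGroup\<close>, so that each automorphism is represented exactly once.\<close>

definition galois_group :: "'k::field poly \<Rightarrow> ('k alg_closure \<Rightarrow> 'k alg_closure) monoid" where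
  "galois_group p =
     (let L = splitting_field p; R = ring_of_type_algebra\<lparr>carrier := L\<rparr>
      in (BijGroup L)\<lparr>carrier :=
           {\<sigma> \<in> Bij L. \<sigma> \<in> ring_hom R R \<and> (\<forall>c. \<sigma> (to_ac c) = to_ac c)}\<rparr>)"

definition root_action ::
  "'k::field poly \<Rightarrow> ('k alg_closure \<Rightarrow> 'k alg_closure) \<Rightarrow> ('k alg_closure \<Rightarrow> 'k alg_closure)" where
  "root_action p \<sigma> = restrict \<sigma> (ac_roots p)"

end

theory Submission
  imports Defs
begin

text \<open>Let \<open>x \<noteq> y\<close> be roots of \<open>f\<close>. The equations \<open>f(x) = f(y) = 0\<close> are linear in \<open>a\<close>, \<open>b\<close> with nonzero
  determinant, so \<open>a\<close>, \<open>b\<close> lie in \<open>\<complex>(x, y)\<close> and \<open>x\<close>, \<open>y\<close> are algebraically independent. Hence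
  \<open>x \<mapsto> z + s\<close>, \<open>y \<mapsto> z - s\<close> embeds \<open>\<complex>(x, y)\<close> into \<open>K((s))\<close>, where \<open>K\<close> is algebraically closed and
  contains a transcendental \<open>z\<close>; the images of \<open>a\<close>, \<open>b\<close> are power series invariant under \<open>s \<mapsto> - s\<close>. Modulo \<open>s\<close>,
  \<open>f\<close> becomes the member of the family that has a double root at \<open>z\<close>. A second multiple root \<open>r\<close> would make the
  vectors \<open>(G\<^sub>0, G\<^sub>1, G\<^sub>2)(z)\<close> and \<open>(G\<^sub>0, G\<^sub>1, G\<^sub>2)(r)\<close> parallel (biduality of plane curves), which the
  hypotheses exclude. So the other \<open>n - 2\<close> roots lift to even power series, and \<open>s \<mapsto> - s\<close> induces the
  transposition of \<open>x\<close> and \<open>y\<close>.\<close>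

section \<open>Embeddings of subfields\<close>

text \<open>Irreducibility enters by excluding a common root of G0, G1, G2; this makes every root
  independent of a, and then any two roots independent of each other. The numerical inequality
  excludes a symmetry: in family (ii) parallel vectors at z and r force r = \<beta> - z, hence
  G0(\<beta> - X) = G0(X), and comparing coefficients makes n even, \<beta> = -2 a_1 / n and the
  forbidden equation true. In family (i) a comparison of degrees and the absence of a common root do
  this job.

  The obstacle at s = 0 is that the two linear equations for a and b coincide there. Half their sum,
  and half their difference divided by s, form a system whose determinant has nonzero constant term,
  so a and b become power series. That the double root has multiplicity exactly two is the
  nonvanishing of the Wronskian of G0, G1, G2, read off from one coefficient.

  K((s)) is not algebraically closed; the embedding extends to all roots of f because n roots of the
  image of f are exhibited. The sign change is then pulled back along it. Every pair x, y is
  covered, so all transpositions occur, and they generate S_n.\<close>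

definition subfld :: "'a::field set \<Rightarrow> bool" where
  "subfld F \<longleftrightarrow> 1 \<in> F \<and> (\<forall>x\<in>F. \<forall>y\<in>F. x - y \<in> F \<and> x * y \<in> F \<and> x / y \<in> F)"

lemma subfldD:
  assumes "subfld F"
  shows "0 \<in> F" "1 \<in> F"
    and "x \<in> F \<Longrightarrow> y \<in> F \<Longrightarrow> x + y \<in> F"
    and "x \<in> F \<Longrightarrow> y \<in> F \<Longrightarrow> x - y \<in> F"
    and "x \<in> F \<Longrightarrow> y \<in> F \<Longrightarrow> x * y \<in> F"
    and "x \<in> F \<Longrightarrow> y \<in> F \<Longrightarrow> x / y \<in> F"
    and "x \<in> F \<Longrightarrow> - x \<in> F"
    and "x \<in> F \<Longrightarrow> inverse x \<in> F"
    and "x \<in> F \<Longrightarrow> x ^ k \<in> F"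
proof -
  note a = assms[unfolded subfld_def]
  show 1: "1 \<in> F" using a by blast
  have "1 - 1 \<in> F" using a 1 by blast
  then show 0: "0 \<in> F" by simp
  show "x - y \<in> F" if "x \<in> F" "y \<in> F" for x y using a that by blast
  show m: "x * y \<in> F" if "x \<in> F" "y \<in> F" for x y using a that by blast
  show "x / y \<in> F" if "x \<in> F" "y \<in> F" for x y using a that by blast
  have "0 - x \<in> F" if "x \<in> F" for x using a that 0 by blast
  then show n: "- x \<in> F" if "x \<in> F" for x using that by simp
  have "x - (- y) \<in> F" if "x \<in> F" "y \<in> F" for x y using a that n by blast
  then show "x + y \<in> F" if "x \<in> F" "y \<in> F" for x y using that by simp
  have "1 / x \<in> F" if "x \<in> F" for x using a that 1 by blast
  then show "inverse x \<in> F" if "x \<in> F" for x using that by (simp add: inverse_eq_divide)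
  show "x ^ k \<in> F" if "x \<in> F" for x by (induction k) (use 1 m that in auto)
qed

lemma subfld_UNIV [simp]: "subfld UNIV"
  by (simp add: subfld_def)

text \<open>Intermediate fields are sets inside one ambient type. An embedding is therefore a total
  function of which only the values on \<open>F\<close> matter, and its domain can grow root by root
  without new types.\<close>

locale field_hom_on =
  fixes F :: "'a::field set" and \<phi> :: "'a \<Rightarrow> 'b::field"
  assumes subfld: "subfld F"
    and hom_one: "\<phi> 1 = 1"
    and hom_add: "\<And>x y. x \<in> F \<Longrightarrow> y \<in> F \<Longrightarrow> \<phi> (x + y) = \<phi> x + \<phi> y"
    and hom_mult: "\<And>x y. x \<in> F \<Longrightarrow> y \<in> F \<Longrightarrow> \<phi> (x * y) = \<phi> x * \<phi> y"
begin

lemmas F_closed = subfldD[OF subfld]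

lemma hom_zero [simp]: "\<phi> 0 = 0"
proof -
  have "\<phi> 0 + \<phi> 0 = \<phi> 0 + 0" using hom_add[of 0 0] F_closed(1) by simp
  then show ?thesis by (simp only: add_left_cancel)
qed

lemma hom_uminus: "x \<in> F \<Longrightarrow> \<phi> (- x) = - \<phi> x"
  using hom_add[of x "- x"] F_closed(7)[of x] by (simp add: add_eq_0_iff2 minus_unique)

lemma hom_diff: "x \<in> F \<Longrightarrow> y \<in> F \<Longrightarrow> \<phi> (x - y) = \<phi> x - \<phi> y"
  using hom_add[of x "- y"] F_closed(7)[of y] by (simp add: hom_uminus)

lemma hom_eq_0_iff: "x \<in> F \<Longrightarrow> \<phi> x = 0 \<longleftrightarrow> x = 0"
  using hom_mult[of x "inverse x"] F_closed(8)[of x] hom_one by (cases "x = 0") auto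

lemma hom_eq_iff: "x \<in> F \<Longrightarrow> y \<in> F \<Longrightarrow> \<phi> x = \<phi> y \<longleftrightarrow> x = y"
  using hom_eq_0_iff[of "x - y"] F_closed(4)[of x y] by (simp add: hom_diff)

lemma inj_hom: "inj_on \<phi> F"
  by (auto simp: inj_on_def hom_eq_iff)

lemma hom_inverse: "x \<in> F \<Longrightarrow> \<phi> (inverse x) = inverse (\<phi> x)"
  using hom_mult[of x "inverse x"] F_closed(8)[of x] hom_one
  by (cases "x = 0") (auto simp: inverse_unique)

lemma hom_divide: "x \<in> F \<Longrightarrow> y \<in> F \<Longrightarrow> \<phi> (x / y) = \<phi> x / \<phi> y"
  using hom_mult[of x "inverse y"] F_closed(8)[of y] by (simp add: hom_inverse divide_inverse)

lemma hom_power: "x \<in> F \<Longrightarrow> \<phi> (x ^ k) = \<phi> x ^ k"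
  by (induction k) (auto simp: hom_one hom_mult F_closed)

lemma subfld_image: "subfld (\<phi> ` F)"
  unfolding subfld_def
proof (intro conjI ballI)
  show "1 \<in> \<phi> ` F" using hom_one F_closed(2) by (metis imageI)
  fix x y assume "x \<in> \<phi> ` F" "y \<in> \<phi> ` F"
  then obtain a b where ab: "a \<in> F" "b \<in> F" "x = \<phi> a" "y = \<phi> b" by blast
  show "x - y \<in> \<phi> ` F" using ab F_closed(4) hom_diff by (metis imageI)
  show "x * y \<in> \<phi> ` F" using ab F_closed(5) hom_mult by (metis imageI)
  show "x / y \<in> \<phi> ` F" using ab F_closed(6) hom_divide by (metis imageI)
qed

lemma subfld_vimage:
  assumes "subfld L"
  shows "subfld {x \<in> F. \<phi> x \<in> L}"
  unfolding subfld_def using F_closed subfldD[OF assms]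
  by (auto simp: hom_one hom_diff hom_mult hom_divide)

lemma restrict_hom: "subfld L \<Longrightarrow> L \<subseteq> F \<Longrightarrow> field_hom_on L \<phi>"
  by unfold_locales (auto simp: hom_one hom_add hom_mult subset_iff)

lemma inv_hom: "field_hom_on (\<phi> ` F) (inv_into F \<phi>)"
proof
  show "subfld (\<phi> ` F)" by (rule subfld_image)
  have i: "inv_into F \<phi> (\<phi> a) = a" if "a \<in> F" for a
    using that inj_hom by simp
  show "inv_into F \<phi> 1 = 1" using i[OF F_closed(2)] hom_one by simp
  fix x y assume "x \<in> \<phi> ` F" "y \<in> \<phi> ` F"
  then obtain a b where ab: "a \<in> F" "b \<in> F" "x = \<phi> a" "y = \<phi> b" by blast
  show "inv_into F \<phi> (x + y) = inv_into F \<phi> x + inv_into F \<phi> y"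
    using ab i F_closed(3) hom_add by metis
  show "inv_into F \<phi> (x * y) = inv_into F \<phi> x * inv_into F \<phi> y"
    using ab i F_closed(5) hom_mult by metis
qed

end

lemma field_hom_on_cong:
  assumes "field_hom_on F \<phi>" "\<And>x. x \<in> F \<Longrightarrow> \<psi> x = \<phi> x"
  shows "field_hom_on F \<psi>"
proof -
  interpret field_hom_on F \<phi> by fact
  show ?thesis
    by unfold_locales (simp_all add: assms(2) F_closed hom_one hom_add hom_mult subfld)
qed

lemma field_hom_on_id: "subfld F \<Longrightarrow> field_hom_on F (\<lambda>x. x)"
  by unfold_locales auto

lemma field_hom_on_comp:
  assumes "field_hom_on F \<phi>" "field_hom_on L \<psi>" "\<phi> ` F \<subseteq> L"
  shows "field_hom_on F (\<lambda>x. \<psi> (\<phi> x))"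
proof -
  interpret h1: field_hom_on F \<phi> by fact
  interpret h2: field_hom_on L \<psi> by fact
  show ?thesis
    by unfold_locales
      (use assms(3) in \<open>auto simp: h1.hom_one h2.hom_one h1.hom_add h1.hom_mult h2.hom_add h2.hom_mult
         image_subset_iff h1.subfld\<close>)
qed

text \<open>Reduces the equality of two homomorphisms on a generated field to the generators: it
  shows that the sign change fixes all of C(a, b), and that an automorphism is determined by its
  action on the roots.\<close>

lemma subfld_eq_hom:
  assumes "field_hom_on F \<phi>" "field_hom_on F \<psi>"
  shows "subfld {x \<in> F. \<phi> x = \<psi> x}"
proof -
  interpret h1: field_hom_on F \<phi> by fact
  interpret h2: field_hom_on F \<psi> by fact
  show ?thesis
    unfolding subfld_def
    by (auto simp: h1.F_closed h1.hom_one h2.hom_one h1.hom_diff h2.hom_diff h1.hom_mult h2.hom_mult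
        h1.hom_divide h2.hom_divide)
qed

section \<open>Polynomials over a subfield and extension of embeddings to roots\<close>

definition polys_over :: "'a::zero set \<Rightarrow> 'a poly set" where
  "polys_over F = {p. \<forall>i. Polynomial.coeff p i \<in> F}"

lemma polys_over_UNIV [simp]: "polys_over UNIV = UNIV"
  by (simp add: polys_over_def)

context
  fixes F :: "'a::field set"
  assumes F: "subfld F"
begin

lemma sum_mem_subfld: "(\<And>i. i \<in> I \<Longrightarrow> h i \<in> F) \<Longrightarrow> sum h I \<in> F"
  by (induction I rule: infinite_finite_induct) (auto simp: subfldD[OF F])

lemma polys_over_closed:
  shows "0 \<in> polys_over F" "1 \<in> polys_over F"
    and "p \<in> polys_over F \<Longrightarrow> q \<in> polys_over F \<Longrightarrow> p + q \<in> polys_over F"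
    and "p \<in> polys_over F \<Longrightarrow> q \<in> polys_over F \<Longrightarrow> p - q \<in> polys_over F"
    and "p \<in> polys_over F \<Longrightarrow> q \<in> polys_over F \<Longrightarrow> p * q \<in> polys_over F"
    and "c \<in> F \<Longrightarrow> p \<in> polys_over F \<Longrightarrow> smult c p \<in> polys_over F"
    and "c \<in> F \<Longrightarrow> Polynomial.monom c k \<in> polys_over F"
    and "c \<in> F \<Longrightarrow> p \<in> polys_over F \<Longrightarrow> pCons c p \<in> polys_over F"
  by (auto simp: polys_over_def subfldD[OF F] coeff_pCons coeff_mult
      intro!: sum_mem_subfld split: nat.splits)

lemma polys_over_division:
  assumes m: "m \<in> polys_over F" "Polynomial.lead_coeff m = 1" and p: "p \<in> polys_over F"
  shows "\<exists>q r. q \<in> polys_over F \<and> r \<in> polys_over F \<and> p = m * q + r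
           \<and> (r = 0 \<or> Polynomial.degree r < Polynomial.degree m)"
  using p
proof (induction "Polynomial.degree p" arbitrary: p rule: less_induct)
  case less
  note D = polys_over_closed
  show ?case
  proof (cases "p = 0 \<or> Polynomial.degree p < Polynomial.degree m")
    case True
    then show ?thesis using less.prems D(1) by (intro exI[of _ 0] exI[of _ p]) auto
  next
    case False
    define t where "t = Polynomial.monom (Polynomial.lead_coeff p) (Polynomial.degree p - Polynomial.degree m)"
    have t: "t \<in> polys_over F" unfolding t_def using less.prems by (intro D) (auto simp: polys_over_def)
    define p' where "p' = p - m * t"
    have p': "p' \<in> polys_over F" unfolding p'_def using less.prems m t D by auto
    have m0: "m \<noteq> 0" using m by auto
    have t0: "t \<noteq> 0" using False by (simp add: t_def)
    have deg: "Polynomial.degree (m * t) = Polynomial.degree p"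
      using False t0 m0 by (subst degree_mult_eq) (auto simp: t_def degree_monom_eq)
    have lc: "Polynomial.lead_coeff (m * t) = Polynomial.lead_coeff p"
      using False by (simp only: lead_coeff_mult m(2)) (simp add: t_def degree_monom_eq)
    have "\<exists>q r. q \<in> polys_over F \<and> r \<in> polys_over F \<and> p' = m * q + r
           \<and> (r = 0 \<or> Polynomial.degree r < Polynomial.degree m)"
    proof (cases "p' = 0")
      case True
      then show ?thesis using D(1) by (intro exI[of _ 0]) auto
    next
      case p'0: False
      have "Polynomial.coeff p' (Polynomial.degree p) = 0" using lc deg by (simp add: p'_def)
      moreover have "Polynomial.degree p' \<le> Polynomial.degree p"
        unfolding p'_def using deg by (intro degree_diff_le) auto
      ultimately have "Polynomial.degree p' < Polynomial.degree p"
        using p'0 by (metis le_neq_implies_less leading_coeff_0_iff)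
      then show ?thesis using less.hyps p' by blast
    qed
    then obtain q r where qr: "q \<in> polys_over F" "r \<in> polys_over F" "p' = m * q + r"
           "r = 0 \<or> Polynomial.degree r < Polynomial.degree m" by blast
    have "p = m * (q + t) + r" using qr(3) by (simp add: p'_def algebra_simps)
    then show ?thesis using qr t D(3) by blast
  qed
qed

end

context field_hom_on
begin

lemma hom_sum: "(\<And>i. i \<in> I \<Longrightarrow> h i \<in> F) \<Longrightarrow> \<phi> (sum h I) = (\<Sum>i\<in>I. \<phi> (h i))"
  by (induction I rule: infinite_finite_induct)
    (auto simp: hom_add sum_mem_subfld[OF subfld])

lemma map_poly_hom:
  shows "map_poly \<phi> 1 = 1"
    and "p \<in> polys_over F \<Longrightarrow> q \<in> polys_over F \<Longrightarrow> map_poly \<phi> (p + q) = map_poly \<phi> p + map_poly \<phi> q"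
    and "p \<in> polys_over F \<Longrightarrow> q \<in> polys_over F \<Longrightarrow> map_poly \<phi> (p - q) = map_poly \<phi> p - map_poly \<phi> q"
    and "p \<in> polys_over F \<Longrightarrow> q \<in> polys_over F \<Longrightarrow> map_poly \<phi> (p * q) = map_poly \<phi> p * map_poly \<phi> q"
    and "c \<in> F \<Longrightarrow> p \<in> polys_over F \<Longrightarrow> map_poly \<phi> (smult c p) = smult (\<phi> c) (map_poly \<phi> p)"
    and "map_poly \<phi> (pCons c p) = pCons (\<phi> c) (map_poly \<phi> p)"
  by (auto intro!: poly_eqI sum.cong
      simp: coeff_map_poly polys_over_def hom_one hom_add hom_diff hom_mult coeff_mult hom_sum
        F_closed coeff_pCons split: nat.splits)

lemma degree_map_poly_hom:
  assumes "p \<in> polys_over F"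
  shows "Polynomial.degree (map_poly \<phi> p) = Polynomial.degree p"
    and "map_poly \<phi> p = 0 \<longleftrightarrow> p = 0"
proof -
  have *: "Polynomial.coeff p i \<in> F" for i using assms by (auto simp: polys_over_def)
  show z: "map_poly \<phi> p = 0 \<longleftrightarrow> p = 0"
    by (metis * coeff_0 coeff_map_poly hom_eq_0_iff hom_zero poly_eqI)
  show "Polynomial.degree (map_poly \<phi> p) = Polynomial.degree p"
    by (cases "p = 0") (auto intro!: map_poly_degree_eq simp: hom_eq_0_iff *)
qed

lemma map_poly_hom_pderiv:
  assumes "p \<in> polys_over F"
  shows "map_poly \<phi> (pderiv p) = pderiv (map_poly \<phi> p)"
proof -
  have n: "of_nat k \<in> F \<and> \<phi> (of_nat k) = of_nat k" for k
    by (induction k) (auto simp: F_closed hom_add hom_one)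
  show ?thesis
    using assms by (intro poly_eqI)
      (auto simp: coeff_map_poly coeff_pderiv polys_over_def hom_mult n hom_add hom_one F_closed
        simp flip: of_nat_Suc)
qed

lemma hom_poly:
  assumes "p \<in> polys_over F" "x \<in> F"
  shows "\<phi> (poly p x) = poly (map_poly \<phi> p) (\<phi> x)"
proof -
  have "\<phi> (poly p x) = (\<Sum>i\<le>Polynomial.degree p. \<phi> (Polynomial.coeff p i * x ^ i))"
    unfolding poly_altdef using assms
    by (intro hom_sum) (auto simp: polys_over_def F_closed)
  also have "\<dots> = poly (map_poly \<phi> p) (\<phi> x)"
    unfolding poly_altdef degree_map_poly_hom(1)[OF assms(1)] using assms
    by (intro sum.cong) (auto simp: polys_over_def F_closed hom_mult hom_power coeff_map_poly)
  finally show ?thesis .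
qed

end

text \<open>Two evaluations of the ring \<open>S\<close> with the same kernel have isomorphic
  images, and the isomorphism passes to fractions. With S = F[X] this adjoins an algebraic element,
  with S = k[X, Y] an independent pair.\<close>

lemma quotient_hom:
  fixes S :: "'r::comm_ring_1 set" and E :: "'r \<Rightarrow> 'a::field" and E' :: "'r \<Rightarrow> 'b::field"
  assumes S: "1 \<in> S" "\<And>p q. p \<in> S \<Longrightarrow> q \<in> S \<Longrightarrow> p - q \<in> S" "\<And>p q. p \<in> S \<Longrightarrow> q \<in> S \<Longrightarrow> p * q \<in> S"
    and E: "E 1 = 1" "\<And>p q. p \<in> S \<Longrightarrow> q \<in> S \<Longrightarrow> E (p - q) = E p - E q"
      "\<And>p q. p \<in> S \<Longrightarrow> q \<in> S \<Longrightarrow> E (p * q) = E p * E q"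
    and E': "E' 1 = 1" "\<And>p q. p \<in> S \<Longrightarrow> q \<in> S \<Longrightarrow> E' (p - q) = E' p - E' q"
      "\<And>p q. p \<in> S \<Longrightarrow> q \<in> S \<Longrightarrow> E' (p * q) = E' p * E' q"
    and ker: "\<And>p. p \<in> S \<Longrightarrow> E p = 0 \<longleftrightarrow> E' p = 0"
  shows "\<exists>F \<phi>. field_hom_on F \<phi> \<and> (\<forall>p\<in>S. E p \<in> F \<and> \<phi> (E p) = E' p)"
proof -
  define F where "F = {E p / E q | p q. p \<in> S \<and> q \<in> S \<and> E q \<noteq> 0}"
  define R where "R = (\<lambda>x pq. fst pq \<in> S \<and> snd pq \<in> S \<and> E (snd pq) \<noteq> 0 \<and> x = E (fst pq) / E (snd pq))"
  define \<phi> where "\<phi> = (\<lambda>x. let pq = (SOME pq. R x pq) in E' (fst pq) / E' (snd pq))"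
  have eq: "E' p / E' q = E' p' / E' q'"
    if "p \<in> S" "q \<in> S" "p' \<in> S" "q' \<in> S" "E q \<noteq> 0" "E q' \<noteq> 0" "E p / E q = E p' / E q'" for p q p' q'
  proof -
    \<comment> \<open>Cross-multiplied, equality of two fractions is membership in the kernel, which
      \<open>E\<close> and \<open>E'\<close> share.\<close>
    have "E (p * q' - p' * q) = 0" using that by (simp add: E S field_simps)
    then have "E' (p * q' - p' * q) = 0" using ker that S by auto
    then show ?thesis using that ker by (simp add: E' S field_simps)
  qed
  have phi: "\<phi> (E p / E q) = E' p / E' q" if "p \<in> S" "q \<in> S" "E q \<noteq> 0" for p q
  proof -
    have "R (E p / E q) (p, q)" using that by (simp add: R_def)
    define pq where "pq = (SOME pq. R (E p / E q) pq)"
    have "R (E p / E q) pq" unfolding pq_def by (rule someI) fact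
    then have "E' (fst pq) / E' (snd pq) = E' p / E' q"
      using that by (intro eq) (auto simp: R_def)
    then show ?thesis by (simp add: \<phi>_def pq_def)
  qed
  have mem: "E p / E q \<in> F" if "p \<in> S" "q \<in> S" "E q \<noteq> 0" for p q
    using that by (auto simp: F_def)
  have zero: "0 \<in> S" using S(2)[of 1 1] S(1) by simp
  have plus: "p + q \<in> S" "E (p + q) = E p + E q" "E' (p + q) = E' p + E' q" if "p \<in> S" "q \<in> S" for p q
  proof -
    have n: "0 - q \<in> S" using S zero that by blast
    have z: "E 0 = 0" "E' 0 = 0" using E(2)[of 1 1] E'(2)[of 1 1] S(1) by auto
    have "p - (0 - q) \<in> S" using S n that by blast
    then show "p + q \<in> S" by simp
    have "E (p - (0 - q)) = E p + E q" "E' (p - (0 - q)) = E' p + E' q"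
      using n that zero z by (simp_all only: E E' n) auto
    then show "E (p + q) = E p + E q" "E' (p + q) = E' p + E' q" by simp_all
  qed
  have sub: "subfld F"
    unfolding subfld_def
  proof (intro conjI ballI)
    show "1 \<in> F" using mem[of 1 1] S E by simp
    fix x y assume "x \<in> F" "y \<in> F"
    then obtain p q r s where *: "p \<in> S" "q \<in> S" "r \<in> S" "s \<in> S" "E q \<noteq> 0" "E s \<noteq> 0"
        "x = E p / E q" "y = E r / E s" unfolding F_def by blast
    have "x - y = E (p * s - r * q) / E (q * s)" using * by (simp add: E S diff_frac_eq)
    moreover have "E (p * s - r * q) / E (q * s) \<in> F" by (rule mem) (use * in \<open>auto intro!: S simp: E\<close>)
    ultimately show "x - y \<in> F" by (simp only:)
    have "x * y = E (p * r) / E (q * s)" using * by (simp add: E S field_simps)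
    moreover have "E (p * r) / E (q * s) \<in> F" by (rule mem) (use * in \<open>auto intro!: S simp: E\<close>)
    ultimately show "x * y \<in> F" by (simp only:)
    show "x / y \<in> F"
    proof (cases "E r = 0")
      case True
      then have "x / y = (E 1 - E 1) / E 1" using * by simp
      also have "\<dots> = E (1 - 1) / E 1" using S E(2)[of 1 1] by simp
      finally show ?thesis using mem[of "1 - 1" 1] zero S(1) E(1) by auto
    next
      case False
      then have "x / y = E (p * s) / E (q * r)" using * by (simp add: E S)
      moreover have "E (p * s) / E (q * r) \<in> F" by (rule mem) (use * False in \<open>auto intro!: S simp: E\<close>)
      ultimately show ?thesis by (simp only:)
    qed
  qed
  have "field_hom_on F \<phi>"
  proof
    show "subfld F" by fact
    show "\<phi> 1 = 1" using phi[of 1 1] S E E' by simp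
    fix x y assume "x \<in> F" "y \<in> F"
    then obtain p q r s where *: "p \<in> S" "q \<in> S" "r \<in> S" "s \<in> S" "E q \<noteq> 0" "E s \<noteq> 0"
        "x = E p / E q" "y = E r / E s" unfolding F_def by blast
    have nz: "E' q \<noteq> 0" "E' s \<noteq> 0" "E (q * s) \<noteq> 0" using * ker E by auto
    have cl: "p * s \<in> S" "r * q \<in> S" "q * s \<in> S" "p * r \<in> S" "p * s + r * q \<in> S" using * S plus by auto
    have "x + y = E (p * s + r * q) / E (q * s)" using * by (simp add: E S plus add_frac_eq)
    then have "\<phi> (x + y) = E' (p * s + r * q) / E' (q * s)" using phi cl nz by auto
    also have "\<dots> = \<phi> x + \<phi> y" using * nz by (simp add: phi E' S plus add_frac_eq)
    finally show "\<phi> (x + y) = \<phi> x + \<phi> y" .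
    have "x * y = E (p * r) / E (q * s)" using * by (simp add: E S field_simps)
    then have "\<phi> (x * y) = E' (p * r) / E' (q * s)" using phi cl nz by auto
    also have "\<dots> = \<phi> x * \<phi> y" using * nz by (simp add: phi E')
    finally show "\<phi> (x * y) = \<phi> x * \<phi> y" .
  qed
  moreover have "E p \<in> F \<and> \<phi> (E p) = E' p" if "p \<in> S" for p
    using mem[of p 1] phi[of p 1] that S E E' by auto
  ultimately show ?thesis by blast
qed

text \<open>Asks for a root of every nonconstant factor because extending an embedding needs a root
  of the image of a minimal polynomial, which is merely some factor. This suits algebraically closed
  targets and K((s)) alike.\<close>

definition splits :: "'a::field poly \<Rightarrow> bool" where
  "splits p \<longleftrightarrow> (\<forall>q. q dvd p \<longrightarrow> Polynomial.degree q > 0 \<longrightarrow> (\<exists>x. poly q x = 0))"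

lemma splits_alg_closed [simp]: "splits (p :: 'a::alg_closed_field poly)"
  by (auto simp: splits_def intro: alg_closed_imp_poly_has_root)

text \<open>If a nonconstant factor had no root, all of \<open>A\<close> would be roots of the
  cofactor, whose degree is too small.\<close>

lemma splits_card:
  fixes p :: "'a::field poly"
  assumes "A \<subseteq> {x. poly p x = 0}" "card A = Polynomial.degree p" "p \<noteq> 0"
  shows "splits p"
  unfolding splits_def
proof (intro allI impI)
  fix q assume q: "q dvd p" "Polynomial.degree q > 0"
  then obtain r where r: "p = q * r" by (auto elim: dvdE)
  show "\<exists>x. poly q x = 0"
  proof (rule ccontr)
    assume no: "\<not> ?thesis"
    then have "A \<subseteq> {x. poly r x = 0}" using assms(1) r by auto
    moreover have "finite {x. poly r x = 0}" using assms(3) r by (auto intro: poly_roots_finite)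
    ultimately have "card A \<le> card {x. poly r x = 0}" by (rule card_mono[rotated])
    also have "\<dots> \<le> Polynomial.degree r" using assms(3) r by (intro card_poly_roots_bound) auto
    finally show False using assms(2,3) q r by (auto simp: degree_mult_eq)
  qed
qed

text \<open>The minimal polynomial \<open>m\<close> of \<open>r\<close> over \<open>F\<close>
  divides \<open>p\<close>, so its image has a root \<open>r'\<close>. Evaluation at
  \<open>r\<close> and evaluation of the image at \<open>r'\<close> have the same kernel, and
  \<open>quotient_hom\<close> applies.\<close>

theorem extend_hom:
  fixes \<phi> :: "'a::field \<Rightarrow> 'b::field"
  assumes hom: "field_hom_on F \<phi>" and p: "p \<in> polys_over F" "p \<noteq> 0" "poly p r = 0"
    and sp: "splits (map_poly \<phi> p)"
  shows "\<exists>F' \<phi>'. field_hom_on F' \<phi>' \<and> insert r F \<subseteq> F' \<and> (\<forall>x\<in>F. \<phi>' x = \<phi> x)"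
proof -
  interpret field_hom_on F \<phi> by fact
  note PC = polys_over_closed[OF subfld]
  define I where "I = {m \<in> polys_over F. m \<noteq> 0 \<and> poly m r = 0}"
  define m0 where "m0 = arg_min Polynomial.degree (\<lambda>m. m \<in> I)"
  have "p \<in> I" using p by (simp add: I_def)
  then have m0: "m0 \<in> I" "\<And>q. q \<in> I \<Longrightarrow> Polynomial.degree m0 \<le> Polynomial.degree q"
    unfolding m0_def by (auto intro: arg_min_natI arg_min_nat_le)
  define m where "m = smult (inverse (Polynomial.lead_coeff m0)) m0"
  have m: "m \<in> polys_over F" "m \<noteq> 0" "poly m r = 0" "Polynomial.lead_coeff m = 1"
    "Polynomial.degree m = Polynomial.degree m0"
    using m0(1) PC F_closed by (auto simp: m_def I_def polys_over_def)
  have min: "Polynomial.degree m \<le> Polynomial.degree q" if "q \<in> polys_over F" "q \<noteq> 0" "poly q r = 0" for q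
    using m0(2)[of q] that m(5) by (simp add: I_def)
  have dvd: "\<exists>h. h \<in> polys_over F \<and> g = m * h" if "g \<in> polys_over F" "poly g r = 0" for g
  proof -
    obtain h t where ht: "h \<in> polys_over F" "t \<in> polys_over F" "g = m * h + t"
       "t = 0 \<or> Polynomial.degree t < Polynomial.degree m"
      using polys_over_division[OF subfld m(1,4) \<open>g \<in> polys_over F\<close>] by blast
    have "poly t r = 0" using ht(3) that m(3) by simp
    then have "t = 0" using min[of t] ht by force
    then show ?thesis using ht by auto
  qed
  have degm: "Polynomial.degree m > 0"
  proof (rule ccontr)
    assume "\<not> ?thesis"
    then obtain c where "m = [:c:]" by (metis degree_eq_zeroE gr0I)
    then show False using m(2,3) by simp
  qed
  obtain h0 where h0: "h0 \<in> polys_over F" "p = m * h0" using dvd p by blast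
  have "map_poly \<phi> m dvd map_poly \<phi> p"
    using h0 m(1) by (simp add: map_poly_hom)
  then obtain r' where r': "poly (map_poly \<phi> m) r' = 0"
    using sp degm degree_map_poly_hom(1)[OF m(1)] unfolding splits_def by metis
  define E where "E = (\<lambda>g. poly g r)"
  define E' where "E' = (\<lambda>g. poly (map_poly \<phi> g) r')"
  have ker1: "E' g = 0" if "g \<in> polys_over F" "E g = 0" for g
    using dvd[of g] that m(1) r' by (auto simp: E_def E'_def map_poly_hom)
  \<comment> \<open>Irreducibility of \<open>m\<close> in disguise: \<open>d\<close> generates the
    kernel of \<open>E'\<close>, hence divides \<open>m\<close>. The cofactor has smaller degree
    than \<open>m\<close> and cannot vanish at \<open>r\<close>, so \<open>d\<close> does, and with
    it its multiple \<open>g\<close>.\<close>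
  have ker2: "E g = 0" if g: "g \<in> polys_over F" "E' g = 0" for g
  proof (rule ccontr)
    assume "E g \<noteq> 0"
    define J where "J = {d \<in> polys_over F. d \<noteq> 0 \<and> E' d = 0}"
    define d0 where "d0 = arg_min Polynomial.degree (\<lambda>m. m \<in> J)"
    have "m \<in> J" using m r' by (simp add: J_def E'_def)
    then have d0: "d0 \<in> J" "\<And>q. q \<in> J \<Longrightarrow> Polynomial.degree d0 \<le> Polynomial.degree q"
      unfolding d0_def by (auto intro: arg_min_natI arg_min_nat_le)
    define d where "d = smult (inverse (Polynomial.lead_coeff d0)) d0"
    have d: "d \<in> polys_over F" "d \<noteq> 0" "E' d = 0" "Polynomial.lead_coeff d = 1"
      "Polynomial.degree d = Polynomial.degree d0"
      using d0(1) PC F_closed by (auto simp: d_def J_def polys_over_def E'_def map_poly_hom)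
    have dd: "\<exists>h. h \<in> polys_over F \<and> q = d * h" if "q \<in> polys_over F" "E' q = 0" for q
    proof -
      obtain h t where ht: "h \<in> polys_over F" "t \<in> polys_over F" "q = d * h + t"
         "t = 0 \<or> Polynomial.degree t < Polynomial.degree d"
        using polys_over_division[OF subfld d(1,4) \<open>q \<in> polys_over F\<close>] by blast
      have "E' t = 0" using ht that d by (simp add: E'_def map_poly_hom PC)
      then have "t = 0" using d0(2)[of t] ht d(5) by (force simp: J_def)
      then show ?thesis using ht by auto
    qed
    have degd: "Polynomial.degree d > 0"
    proof (rule ccontr)
      assume "\<not> ?thesis"
      then obtain c where "d = [:c:]" by (metis degree_eq_zeroE gr0I)
      then have "d = 1" using d(4) by (simp add: one_pCons)
      then show False using d(3) by (simp add: E'_def map_poly_hom)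
    qed
    obtain h where h: "h \<in> polys_over F" "m = d * h" using dd[of m] m r' by (auto simp: E'_def)
    have h0: "h \<noteq> 0" using m h by auto
    have degs: "Polynomial.degree m = Polynomial.degree d + Polynomial.degree h"
      using h h0 d(2) by (simp add: degree_mult_eq)
    have "poly h r \<noteq> 0" using min[of h] h h0 degs degd by auto
    then have "poly d r = 0" using m(3) h by auto
    moreover obtain h' where "g = d * h'" using dd[of g] g by blast
    ultimately show False using \<open>E g \<noteq> 0\<close> by (simp add: E_def)
  qed
  have "\<exists>F' \<psi>. field_hom_on F' \<psi> \<and> (\<forall>g\<in>polys_over F. E g \<in> F' \<and> \<psi> (E g) = E' g)"
    by (rule quotient_hom) (use ker1 ker2 PC in \<open>auto simp: E_def E'_def map_poly_hom\<close>)
  then obtain F' \<psi> where F': "field_hom_on F' \<psi>" "\<And>g. g \<in> polys_over F \<Longrightarrow> E g \<in> F' \<and> \<psi> (E g) = E' g"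
    by blast
  have "r \<in> F'" using F'(2)[of "[:0, 1:]"] PC F_closed by (simp add: E_def)
  moreover have "x \<in> F' \<and> \<psi> x = \<phi> x" if "x \<in> F" for x
    using F'(2)[of "[:x:]"] PC that by (simp add: E_def E'_def map_poly_hom)
  ultimately show ?thesis using F'(1) by blast
qed

theorem extend_hom_set:
  fixes \<phi> :: "'a::field \<Rightarrow> 'b::field"
  assumes "finite A" "field_hom_on F \<phi>" "p \<in> polys_over F" "p \<noteq> 0" "\<And>r. r \<in> A \<Longrightarrow> poly p r = 0"
    "splits (map_poly \<phi> p)"
  shows "\<exists>F' \<phi>'. field_hom_on F' \<phi>' \<and> A \<union> F \<subseteq> F' \<and> (\<forall>x\<in>F. \<phi>' x = \<phi> x)"
  using assms(1,5)
proof (induction A)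
  case empty
  then show ?case using assms by blast
next
  case (insert r A)
  then obtain F' \<psi> where F': "field_hom_on F' \<psi>" "A \<union> F \<subseteq> F'" "\<And>x. x \<in> F \<Longrightarrow> \<psi> x = \<phi> x" by auto
  have "p \<in> polys_over F'" using assms(3) F'(2) by (auto simp: polys_over_def)
  moreover have "map_poly \<psi> p = map_poly \<phi> p"
    using F'(3) assms(3) field_hom_on.hom_zero[OF F'(1)] field_hom_on.hom_zero[OF assms(2)]
    by (auto intro!: poly_eqI simp: coeff_map_poly polys_over_def)
  ultimately have "\<exists>F'' \<phi>'. field_hom_on F'' \<phi>' \<and> insert r F' \<subseteq> F'' \<and> (\<forall>x\<in>F'. \<phi>' x = \<psi> x)"
    using F'(1) assms insert.prems by (intro extend_hom[of _ _ p]) auto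
  then show ?case using F' by (smt (verit) Un_iff insert_iff subset_iff)
qed

section \<open>Evaluation of polynomials in one and two variables\<close>

definition ring_hm :: "('a::comm_ring_1 \<Rightarrow> 'b::comm_ring_1) \<Rightarrow> bool" where
  "ring_hm e \<longleftrightarrow> e 1 = 1 \<and> (\<forall>x y. e (x + y) = e x + e y) \<and> (\<forall>x y. e (x * y) = e x * e y)"

lemma ring_hmD:
  assumes "ring_hm e"
  shows "e 1 = 1" "e (x + y) = e x + e y" "e (x * y) = e x * e y" "e 0 = 0" "e (- x) = - e x"
    "e (x - y) = e x - e y" "e (of_nat k) = of_nat k" "e (x ^ k) = e x ^ k" "e (sum h I) = (\<Sum>i\<in>I. e (h i))"
proof -
  have a: "e (x + y) = e x + e y" and m: "e (x * y) = e x * e y" and 1: "e 1 = 1" for x y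
    using assms by (auto simp: ring_hm_def)
  show "e 1 = 1" "e (x + y) = e x + e y" "e (x * y) = e x * e y" by (fact 1 a m)+
  have "e 0 + e 0 = e 0 + 0" using a[of 0 0] by simp
  then show z: "e 0 = 0" by (simp only: add_left_cancel)
  have n: "e (- x) = - e x" for x using a[of x "- x"] z by (simp add: add_eq_0_iff2 minus_unique)
  then show "e (- x) = - e x" .
  show "e (x - y) = e x - e y" using a[of x "- y"] n by simp
  show "e (of_nat k) = of_nat k" by (induction k) (auto simp: z a 1)
  show "e (x ^ k) = e x ^ k" by (induction k) (auto simp: m 1)
  show "e (sum h I) = (\<Sum>i\<in>I. e (h i))"
    by (induction I rule: infinite_finite_induct) (auto simp: z a)
qed

lemma ring_hm_imp_field_hom_on: "ring_hm e \<Longrightarrow> subfld F \<Longrightarrow> field_hom_on F e"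
  by unfold_locales (auto simp: ring_hm_def)

lemma ring_hm_eq_iff:
  fixes e :: "'a::field \<Rightarrow> 'b::field"
  assumes "ring_hm e"
  shows "e x = e y \<longleftrightarrow> x = y" "e x = 0 \<longleftrightarrow> x = 0"
proof -
  interpret field_hom_on UNIV e by (rule ring_hm_imp_field_hom_on) (use assms in auto)
  show "e x = e y \<longleftrightarrow> x = y" "e x = 0 \<longleftrightarrow> x = 0" using hom_eq_iff hom_eq_0_iff by auto
qed

lemma ring_hm_comp: "ring_hm e \<Longrightarrow> ring_hm f \<Longrightarrow> ring_hm (\<lambda>x. f (e x))"
  by (auto simp: ring_hm_def)

lemma ring_hm_map_poly: "ring_hm e \<Longrightarrow> ring_hm (map_poly e)"
  unfolding ring_hm_def[of "map_poly e"]
  by (auto intro!: poly_eqI simp: coeff_map_poly ring_hmD coeff_mult)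

lemma ring_hm_poly: "ring_hm (\<lambda>p. poly p u)"
  by (auto simp: ring_hm_def)

text \<open>The embedding \<open>e\<close> of the constants is a parameter because the same
  polynomials are evaluated in the closure of C(a, b), in power series and in Laurent series, with
  complex or rational constants.\<close>

definition ev1 :: "('k::comm_ring_1 \<Rightarrow> 'a::comm_ring_1) \<Rightarrow> 'a \<Rightarrow> 'k poly \<Rightarrow> 'a" where
  "ev1 e u p = poly (map_poly e p) u"

definition ev2 :: "('k::comm_ring_1 \<Rightarrow> 'a::comm_ring_1) \<Rightarrow> 'a \<Rightarrow> 'a \<Rightarrow> 'k poly poly \<Rightarrow> 'a" where
  "ev2 e u v P = poly (map_poly (ev1 e u) P) v"

lemma ring_hm_ev1: "ring_hm e \<Longrightarrow> ring_hm (ev1 e u)"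
  unfolding ev1_def by (rule ring_hm_comp[OF ring_hm_map_poly ring_hm_poly])

lemma ring_hm_ev2: "ring_hm e \<Longrightarrow> ring_hm (ev2 e u v)"
  unfolding ev2_def by (rule ring_hm_comp[OF ring_hm_map_poly ring_hm_poly]) (rule ring_hm_ev1)

lemma ev1_pCons: "ring_hm e \<Longrightarrow> ev1 e u (pCons c p) = e c + u * ev1 e u p"
  by (simp add: ev1_def map_poly_pCons ring_hmD)

lemma ev2_pCons: "ring_hm e \<Longrightarrow> ev2 e u v (pCons p P) = ev1 e u p + v * ev2 e u v P"
  using ring_hm_ev1[of e u] by (simp add: ev2_def map_poly_pCons ring_hmD)

lemma ev1_0 [simp]: "ev1 e u 0 = 0" and ev2_0 [simp]: "ev2 e u v 0 = 0"
  by (simp_all add: ev1_def ev2_def)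

lemma ev1_const: "ring_hm e \<Longrightarrow> ev1 e u [:c:] = e c"
  by (simp add: ev1_pCons)

lemma ev2_const: "ring_hm e \<Longrightarrow> ev2 e u v [:p:] = ev1 e u p"
  by (simp add: ev2_pCons)

lemma ev1_monom: "ring_hm e \<Longrightarrow> ev1 e u (Polynomial.monom c k) = e c * u ^ k"
  by (simp add: ev1_def map_poly_monom ring_hmD poly_monom)

lemma ev2_smult: "ring_hm e \<Longrightarrow> ev2 e u v (smult c p) = ev1 e u c * ev2 e u v p"
  using ring_hmD(3)[OF ring_hm_ev2, of e u v "[:c:]" p] by (simp add: ev2_const)

definition X2 :: "'k::comm_ring_1 poly poly" where "X2 = [:[:0, 1:]:]"
definition Y2 :: "'k::comm_ring_1 poly poly" where "Y2 = [:0, 1:]"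
definition C2 :: "'k::comm_ring_1 \<Rightarrow> 'k poly poly" where "C2 c = [:[:c:]:]"

lemma ev2_basic:
  assumes "ring_hm e"
  shows "ev2 e u v X2 = u" "ev2 e u v Y2 = v" "ev2 e u v (C2 c) = e c"
  using assms ring_hmD(1)[OF ring_hm_ev1[OF assms]]
  by (simp_all add: X2_def Y2_def C2_def ev2_pCons ev1_pCons ring_hmD)

lemma ring_hm_C2: "ring_hm C2"
  by (simp add: ring_hm_def C2_def one_pCons)

text \<open>Universal property of k[X][Y], by which identities between evaluations are checked on
  constants and the two variables.\<close>

lemma poly_poly_hom_unique:
  assumes "ring_hm f" "ring_hm g" "\<And>c. f (C2 c) = g (C2 c)" "f X2 = g X2" "f Y2 = g Y2"
  shows "f P = g P"
proof -
  have c: "f [:p:] = g [:p:]" for p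
  proof (induction p)
    case 0
    then show ?case using assms(1,2) by (simp add: ring_hmD)
  next
    case (pCons c p)
    have eq: "[:pCons c p:] = C2 c + X2 * [:p:]" by (simp add: C2_def X2_def)
    show ?case unfolding eq
      by (simp only: ring_hmD(2,3)[OF assms(1)] ring_hmD(2,3)[OF assms(2)] pCons assms(3,4))
  qed
  show ?thesis
  proof (induction P)
    case 0
    then show ?case using assms(1,2) by (simp add: ring_hmD)
  next
    case (pCons p P)
    have eq: "pCons p P = [:p:] + Y2 * P" by (simp add: Y2_def)
    show ?case unfolding eq
      by (simp only: ring_hmD(2,3)[OF assms(1)] ring_hmD(2,3)[OF assms(2)] pCons c assms(5))
  qed
qed

lemma ev2_ev2:
  assumes "ring_hm e"
  shows "ev2 e u v (ev2 C2 U V P) = ev2 e (ev2 e u v U) (ev2 e u v V) P"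
  by (rule poly_poly_hom_unique[OF ring_hm_comp])
    (auto simp: ring_hm_ev2 ring_hm_C2 assms ev2_basic)

lemma ev2_C2_X2_Y2: "ev2 C2 X2 Y2 P = P"
  by (rule poly_poly_hom_unique[OF _ ring_hm_comp[where f = "\<lambda>x. x" and e = "\<lambda>x. x"]])
    (auto simp: ring_hm_ev2 ring_hm_C2 ev2_basic, auto simp: ring_hm_def)

section \<open>Transcendence and algebraic independence\<close>

definition transc :: "('k::field \<Rightarrow> 'a::field) \<Rightarrow> 'a \<Rightarrow> bool" where
  "transc e u \<longleftrightarrow> (\<forall>p. ev1 e u p = 0 \<longrightarrow> p = 0)"

definition indep :: "('k::field \<Rightarrow> 'a::field) \<Rightarrow> 'a \<Rightarrow> 'a \<Rightarrow> bool" where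
  "indep e u v \<longleftrightarrow> (\<forall>P. ev2 e u v P = 0 \<longrightarrow> P = 0)"

text \<open>The substitution (U', V') inverts (U, V). A relation between the new elements pulls back
  to one between \<open>u\<close> and \<open>v\<close>, which is zero; applying the inverse recovers
  the original relation as zero.\<close>

lemma indep_substitute:
  assumes "ring_hm e" "indep e u v"
    and "ev2 C2 U' V' U = X2" "ev2 C2 U' V' V = Y2"
  shows "indep e (ev2 e u v U) (ev2 e u v V)"
  unfolding indep_def
proof (intro allI impI)
  fix P assume "ev2 e (ev2 e u v U) (ev2 e u v V) P = 0"
  then have "ev2 C2 U V P = 0" using assms(1,2) by (simp add: indep_def flip: ev2_ev2)
  then have "ev2 C2 U' V' (ev2 C2 U V P) = 0" by simp
  then show "P = 0" using assms(3,4) by (simp add: ev2_ev2 ring_hm_C2 ev2_C2_X2_Y2)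
qed

lemma ev2_arith:
  assumes "ring_hm e"
  shows "ev2 e u v (P + Q) = ev2 e u v P + ev2 e u v Q" "ev2 e u v (P - Q) = ev2 e u v P - ev2 e u v Q"
    "ev2 e u v (P * Q) = ev2 e u v P * ev2 e u v Q"
  using ring_hm_ev2[OF assms] by (simp_all add: ring_hmD)

lemma indep_swap: "ring_hm e \<Longrightarrow> indep e u v \<Longrightarrow> indep e v u"
  using indep_substitute[of e u v Y2 X2 Y2 X2] by (simp add: ev2_basic ring_hm_C2)

lemma indep_shift: "ring_hm e \<Longrightarrow> indep e u v \<Longrightarrow> indep e u (v + e c)"
  using indep_substitute[of e u v X2 "Y2 - C2 c" X2 "Y2 + C2 c"]
  by (simp add: ev2_basic ring_hm_C2 ev2_arith)

lemma indep_sum_diff: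
  fixes u v :: "'a::field" and e :: "'k::field_char_0 \<Rightarrow> 'a"
  assumes e: "ring_hm e" and "indep e u v"
  shows "indep e (u + v) (u - v)"
proof -
  have "C2 (1/2) * (X2 + Y2) + C2 (1/2) * (X2 - Y2) = (X2 :: 'k poly poly)"
     "C2 (1/2) * (X2 + Y2) - C2 (1/2) * (X2 - Y2) = (Y2 :: 'k poly poly)"
    by (auto simp: C2_def X2_def Y2_def)
  then show ?thesis
    using indep_substitute[OF assms, of "C2 (1/2) * (X2 + Y2)" "C2 (1/2) * (X2 - Y2)" "X2 + Y2" "X2 - Y2"]
    by (simp add: ev2_basic ring_hm_C2 ev2_arith e)
qed

lemma indep_imp_transc: 
  assumes "ring_hm e" "indep e u v"
  shows "transc e u" "transc e v"
proof -
  have *: "transc e u" if "indep e u v" for u v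
    unfolding transc_def
  proof (intro allI impI)
    fix p assume "ev1 e u p = 0"
    then have "ev2 e u v [:p:] = 0" using assms(1) by (simp add: ev2_const)
    then show "p = 0" using that unfolding indep_def by fastforce
  qed
  show "transc e u" "transc e v" using * assms indep_swap by blast+
qed

lemma hom_ev1:
  assumes "field_hom_on F \<phi>" "ring_hm e" "ring_hm e'" "\<And>c. e c \<in> F \<and> \<phi> (e c) = e' c" "u \<in> F"
  shows "ev1 e u p \<in> F \<and> \<phi> (ev1 e u p) = ev1 e' (\<phi> u) p"
proof -
  interpret field_hom_on F \<phi> by fact
  show ?thesis using assms
    by (induction p) (auto simp: F_closed ev1_pCons hom_add hom_mult)
qed

lemma hom_ev2:
  assumes "field_hom_on F \<phi>" "ring_hm e" "ring_hm e'" "\<And>c. e c \<in> F \<and> \<phi> (e c) = e' c" "u \<in> F" "v \<in> F"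
  shows "ev2 e u v P \<in> F \<and> \<phi> (ev2 e u v P) = ev2 e' (\<phi> u) (\<phi> v) P"
proof -
  interpret field_hom_on F \<phi> by fact
  show ?thesis using assms hom_ev1[OF assms(1-5)]
    by (induction P) (auto simp: F_closed ev2_pCons hom_add hom_mult)
qed

text \<open>Both evaluations of k[X, Y] have zero kernel, so \<open>quotient_hom\<close> identifies
  the two fraction fields.\<close>

theorem indep_hom:
  fixes e :: "'k::field \<Rightarrow> 'a::field" and e' :: "'k \<Rightarrow> 'b::field"
  assumes e: "ring_hm e" "indep e u v" and e': "ring_hm e'" "indep e' u' v'"
  shows "\<exists>F \<phi>. field_hom_on F \<phi> \<and> u \<in> F \<and> v \<in> F \<and> \<phi> u = u' \<and> \<phi> v = v' \<and> (\<forall>c. e c \<in> F \<and> \<phi> (e c) = e' c)"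
proof -
  have "\<exists>F \<phi>. field_hom_on F \<phi> \<and> (\<forall>p\<in>UNIV. ev2 e u v p \<in> F \<and> \<phi> (ev2 e u v p) = ev2 e' u' v' p)"
    by (rule quotient_hom) (use ring_hm_ev2[OF e(1), of u v] ring_hm_ev2[OF e'(1), of u' v'] e(2) e'(2)
        in \<open>auto simp: ring_hmD indep_def\<close>)
  then obtain F \<phi> where F: "field_hom_on F \<phi>" "\<And>p. ev2 e u v p \<in> F \<and> \<phi> (ev2 e u v p) = ev2 e' u' v' p"
    by blast
  show ?thesis
    using F(1) F(2)[of X2] F(2)[of Y2] F(2)[of "C2 _"] e(1) e'(1) by (auto simp: ev2_basic)
qed

text \<open>The translates \<open>v + c\<close> of \<open>v\<close> all extend to the algebraic element \<open>w\<close>, which has only finitely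
  many conjugates over \<open>k(u)\<close>; so two of them send \<open>w\<close> to the same conjugate.\<close>
theorem algebraic_linear_relation:
  fixes e :: "'k::field_char_0 \<Rightarrow> 'a::alg_closed_field"
  assumes e: "ring_hm e" "indep e u v"
    and alg: "ev2 e u w Q = 0" "Q \<noteq> 0"
    and rel: "ev2 e u w A + v * ev2 e u w B = 0"
  shows "\<exists>w'. ev2 e u w' A = 0 \<and> ev2 e u w' B = 0 \<and> (w \<noteq> u \<longrightarrow> w' \<noteq> u)"
proof -
  define p where "p = map_poly (ev1 e u) Q"
  have tr: "transc e u" using indep_imp_transc e by blast
  have "p \<noteq> 0"
  proof
    assume "p = 0"
    then have "Polynomial.coeff p i = 0" for i by simp
    then have "ev1 e u (Polynomial.coeff Q i) = 0" for i by (simp add: p_def coeff_map_poly)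
    then have "Q = 0" using tr by (auto simp: transc_def intro: poly_eqI)
    with alg show False by blast
  qed
  have "\<exists>w'. poly p w' = 0 \<and> ev2 e u w' A + (v + e c) * ev2 e u w' B = 0 \<and> (w \<noteq> u \<longrightarrow> w' \<noteq> u)" for c
  proof -
    obtain F \<phi> where F: "field_hom_on F \<phi>" "u \<in> F" "v \<in> F" "\<phi> u = u" "\<phi> v = v + e c" 
      "\<And>c. e c \<in> F \<and> \<phi> (e c) = e c"
      using indep_hom[OF e e(1) indep_shift[OF e]] by blast
    have E: "ev1 e u q \<in> F" "\<phi> (ev1 e u q) = ev1 e u q" for q
      using hom_ev1[OF F(1) e(1) e(1) F(6,2)] F(4) by auto
    have pF: "p \<in> polys_over F" by (auto simp: p_def polys_over_def coeff_map_poly E)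
    have "poly p w = 0" using alg by (simp add: p_def ev2_def)
    from extend_hom[OF F(1) pF \<open>p \<noteq> 0\<close> this splits_alg_closed]
    obtain F' \<psi> where F': "field_hom_on F' \<psi>" "insert w F \<subseteq> F'" "\<And>x. x \<in> F \<Longrightarrow> \<psi> x = \<phi> x"
      by blast
    interpret field_hom_on F' \<psi> by fact
    have c: "e c \<in> F' \<and> \<psi> (e c) = e c" for c using F' F(6) by auto
    have H: "ev2 e u w P \<in> F' \<and> \<psi> (ev2 e u w P) = ev2 e u (\<psi> w) P" for P
      using hom_ev2[OF F'(1) e(1) e(1) c, of u w] F F' by auto
    have "poly p (\<psi> w) = 0" using H[of Q] alg by (simp add: p_def ev2_def)
    moreover have "ev2 e u (\<psi> w) A + (v + e c) * ev2 e u (\<psi> w) B = 0"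
    proof -
      have "v \<in> F'" "\<psi> v = v + e c" using F F' by auto
      then have "\<psi> (ev2 e u w A + v * ev2 e u w B) = ev2 e u (\<psi> w) A + (v + e c) * ev2 e u (\<psi> w) B"
        using H by (simp add: hom_add hom_mult F_closed)
      then show ?thesis using rel by simp
    qed
    moreover have "\<psi> w \<noteq> u" if "w \<noteq> u" 
      using hom_eq_iff[of w u] that F F' by auto
    ultimately show ?thesis by blast
  qed
  then obtain W where W: "\<And>c. poly p (W c) = 0" "\<And>c. ev2 e u (W c) A + (v + e c) * ev2 e u (W c) B = 0"
    "\<And>c. w \<noteq> u \<Longrightarrow> W c \<noteq> u" by metis
  have "finite (range W)"
    by (rule finite_subset[OF _ poly_roots_finite[OF \<open>p \<noteq> 0\<close>]]) (use W in auto)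
  then have "\<not> inj W" using infinite_UNIV_char_0 finite_imageD by blast
  then obtain c d where cd: "c \<noteq> d" "W c = W d" by (auto simp: inj_def)
  \<comment> \<open>For a conjugate shared by two translates, subtracting the relations cancels
    \<open>A\<close> and \<open>v\<close>; so \<open>B\<close> vanishes there, and then
    \<open>A\<close> too.\<close>
  have "(e c - e d) * ev2 e u (W c) B
      = (ev2 e u (W c) A + (v + e c) * ev2 e u (W c) B) - (ev2 e u (W c) A + (v + e d) * ev2 e u (W c) B)"
    by (simp add: algebra_simps)
  also have "\<dots> = 0"
    using W(2)[of c] W(2)[of d] cd(2) by simp
  finally have "(e c - e d) * ev2 e u (W c) B = 0" .
  then have "ev2 e u (W c) B = 0" using cd(1) ring_hm_eq_iff[OF e(1)] by simp
  then show ?thesis using W(2)[of c] W(3)[of c] by auto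
qed

section \<open>The generic pencil\<close>

type_synonym ratfun_closure = "complex ratfun2 alg_closure"

definition emb :: "complex \<Rightarrow> ratfun_closure" where
  "emb c = to_ac (ratfun2_const c)"

definition gen_a :: ratfun_closure where "gen_a = to_ac indet_a"
definition gen_b :: ratfun_closure where "gen_b = to_ac indet_b"

lemma ring_hm_to_ac_to_fract: "ring_hm (\<lambda>P :: 'k::field poly poly. to_ac (to_fract P))"
  by (simp add: ring_hm_def)

lemma ring_hm_emb: "ring_hm emb"
  using ring_hm_comp[OF ring_hm_C2 ring_hm_to_ac_to_fract]
  by (simp add: emb_def[abs_def] ratfun2_const_def C2_def)

lemma ev2_gen: "ev2 emb gen_a gen_b P = to_ac (to_fract P)"
  by (rule poly_poly_hom_unique[OF ring_hm_ev2[OF ring_hm_emb] ring_hm_to_ac_to_fract])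
    (simp_all only: ev2_basic[OF ring_hm_emb],
     simp_all add: emb_def gen_a_def gen_b_def indet_a_def indet_b_def ratfun2_const_def C2_def X2_def Y2_def)

lemma indep_gen: "indep emb gen_a gen_b"
  by (simp add: indep_def ev2_gen)

lemma range_to_ac_subset:
  assumes "subfld L" "range emb \<subseteq> L" "gen_a \<in> L" "gen_b \<in> L"
  shows "range to_ac \<subseteq> L"
proof (intro subsetI)
  fix x :: ratfun_closure assume "x \<in> range to_ac"
  then obtain c where c: "x = to_ac c" by blast
  have "c = to_fract (fst (quot_of_fract c)) / to_fract (snd (quot_of_fract c))"
    by (simp add: Fract_conv_to_fract[symmetric] Fract_quot_of_fract flip: Fract_conv_to_fract)
  then have "x = ev2 emb gen_a gen_b (fst (quot_of_fract c)) / ev2 emb gen_a gen_b (snd (quot_of_fract c))"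
    by (simp add: c ev2_gen flip: to_ac_divide)
  moreover have "ev2 emb gen_a gen_b P \<in> L" for P
    using hom_ev2[of L "\<lambda>x. x" emb emb gen_a gen_b P] assms ring_hm_emb
    by (auto intro: field_hom_on_id)
  ultimately show "x \<in> L" using subfldD(6)[OF assms(1)] by simp
qed

text \<open>Cramer's rule. The formulas show that a and b lie in every field containing the
  coefficients, and that two solutions of one system agree.\<close>

lemma linear_system_unique:
  fixes a b :: "'a::field"
  assumes "p0 + a * p1 + b * p2 = 0" "q0 + a * q1 + b * q2 = 0" "q1 * p2 - p1 * q2 \<noteq> 0"
  shows "a = (p0 * q2 - q0 * p2) / (q1 * p2 - p1 * q2)"
    and "b = (q0 * p1 - p0 * q1) / (q1 * p2 - p1 * q2)"
proof -
  have "a * (q1 * p2 - p1 * q2) - (p0 * q2 - q0 * p2)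
     = (q0 + a * q1 + b * q2) * p2 - (p0 + a * p1 + b * p2) * q2" by (simp add: algebra_simps)
  then show "a = (p0 * q2 - q0 * p2) / (q1 * p2 - p1 * q2)" using assms by (simp add: eq_divide_eq)
  have "b * (q1 * p2 - p1 * q2) - (q0 * p1 - p0 * q1)
     = (p0 + a * p1 + b * p2) * q1 - (q0 + a * q1 + b * q2) * p1" by (simp add: algebra_simps)
  then show "b = (q0 * p1 - p0 * q1) / (q1 * p2 - p1 * q2)" using assms by (simp add: eq_divide_eq)
qed

text \<open>Peeling off linear factors over the algebraically closed field of constants: an element
  algebraic over the complex numbers is a constant.\<close>

lemma ev1_root_complex:
  fixes e :: "complex \<Rightarrow> 'a::field"
  assumes e: "ring_hm e" and "ev1 e w p = 0" "p \<noteq> 0"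
  shows "\<exists>c. w = e c \<and> poly p c = 0"
  using assms(2,3)
proof (induction "Polynomial.degree p" arbitrary: p rule: less_induct)
  case less
  show ?case
  proof (cases "Polynomial.degree p = 0")
    case True
    then obtain c where "p = [:c:]" by (metis degree_eq_zeroE)
    then show ?thesis using less.prems e by (auto simp: ev1_const ring_hm_eq_iff)
  next
    case False
    then obtain c where c: "poly p c = 0" using alg_closed_imp_poly_has_root by blast
    then obtain q where q: "p = [:- c, 1:] * q" by (metis dvdE poly_eq_0_iff_dvd)
    then have "(w - e c) * ev1 e w q = 0"
      using less.prems(1) by (simp only: ring_hmD(3)[OF ring_hm_ev1[OF e]])
        (simp add: ev1_pCons e ring_hmD)
    moreover have "Polynomial.degree q < Polynomial.degree p" "q \<noteq> 0"
      using less.prems(2) q by (auto simp: degree_mult_eq simp del: mult_pCons_left)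
    ultimately show ?thesis using less.hyps[of q] c q by force
  qed
qed

text \<open>Places \<open>p\<close> in the outer variable, whereas \<open>[:p:]\<close> places it in
  the inner one; together they express conditions on a pair of roots.\<close>

definition lift_y :: "'k::comm_ring_1 poly \<Rightarrow> 'k poly poly" where
  "lift_y p = map_poly (\<lambda>c. [:c:]) p"

lemma ev2_lift_y: "ring_hm e \<Longrightarrow> ev2 e u v (lift_y p) = ev1 e v p"
  by (auto simp: ev2_def lift_y_def ev1_def[of e v] map_poly_map_poly ev1_const o_def)

lemma coeff_lift_y: "Polynomial.coeff (lift_y p) i = [:Polynomial.coeff p i:]"
  by (simp add: lift_y_def coeff_map_poly)

lemma card_roots_alg_closed:
  fixes p :: "'a::alg_closed_field poly"
  assumes "\<And>x. poly p x = 0 \<Longrightarrow> poly (pderiv p) x \<noteq> 0" "p \<noteq> 0"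
  shows "card {x. poly p x = 0} = Polynomial.degree p"
  using assms
proof (induction "Polynomial.degree p" arbitrary: p rule: less_induct)
  case less
  show ?case
  proof (cases "Polynomial.degree p = 0")
    case True
    then obtain c where "p = [:c:]" by (metis degree_eq_zeroE)
    then show ?thesis using less.prems by auto
  next
    case False
    then obtain c where c: "poly p c = 0" using alg_closed_imp_poly_has_root by blast
    then obtain q where q: "p = [:- c, 1:] * q" by (metis dvdE poly_eq_0_iff_dvd)
    have q0: "q \<noteq> 0" and deg: "Polynomial.degree p = Suc (Polynomial.degree q)"
      using less.prems(2) q by (auto simp: degree_mult_eq simp del: mult_pCons_left)
    have d: "poly (pderiv p) x = poly q x + (x - c) * poly (pderiv q) x" for x
      unfolding q pderiv_mult by (simp add: pderiv_pCons algebra_simps del: mult_pCons_left)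
    have "poly q c \<noteq> 0" using less.prems(1)[OF c] d[of c] by simp
    moreover have "poly (pderiv q) x \<noteq> 0" if "poly q x = 0" for x
      using less.prems(1)[of x] d[of x] that q by auto
    then have "card {x. poly q x = 0} = Polynomial.degree q"
      using less.hyps deg q0 by simp
    moreover have "{x. poly p x = 0} = insert c {x. poly q x = 0}" by (auto simp: q)
    ultimately show ?thesis using deg poly_roots_finite[OF q0] by simp
  qed
qed

text \<open>The assumptions concern the plane curve t -> (G0 : G1 : G2)(t).
  \<open>not_parallel\<close>: no other parameter gives the point at a generic one.
  \<open>minor_nz\<close>: the generic tangent line belongs to finite values of a and b.
  \<open>wronskian_nz\<close>: the generic point is not a flex.\<close>

locale generic_pencil =
  fixes G0 G1 G2 :: "complex poly" and n :: nat
  assumes deg_G0: "Polynomial.degree G0 = n" "Polynomial.lead_coeff G0 = 1"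
    and deg_lt: "Polynomial.degree G1 < n" "Polynomial.degree G2 < n"
    and no_common_root: "\<And>c. poly G0 c = 0 \<Longrightarrow> poly G1 c = 0 \<Longrightarrow> poly G2 c \<noteq> 0"
    and not_parallel: "\<And>u w. transc emb u \<Longrightarrow> w \<noteq> u \<Longrightarrow>
        ev1 emb w G1 * ev1 emb u G2 - ev1 emb u G1 * ev1 emb w G2 = 0 \<Longrightarrow>
        ev1 emb w G0 * ev1 emb u G2 - ev1 emb u G0 * ev1 emb w G2 \<noteq> 0"
    and minor_nz: "pderiv G1 * G2 - G1 * pderiv G2 \<noteq> 0"
    and wronskian_nz:
      "G0 * (pderiv G1 * pderiv (pderiv G2) - pderiv (pderiv G1) * pderiv G2)
        + G1 * (pderiv G2 * pderiv (pderiv G0) - pderiv (pderiv G2) * pderiv G0)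
        + G2 * (pderiv G0 * pderiv (pderiv G1) - pderiv (pderiv G0) * pderiv G1) \<noteq> 0"
begin

definition f :: "complex ratfun2 poly" where "f = family2 G0 G1 G2"

abbreviation g :: "complex poly \<Rightarrow> ratfun_closure \<Rightarrow> ratfun_closure" where
  "g G x \<equiv> ev1 emb x G"

definition fhat :: "ratfun_closure poly" where "fhat = map_poly to_ac f"

lemma G2_nz: "G2 \<noteq> 0" using minor_nz by auto

lemma fhat_eq: "fhat = map_poly emb G0 + smult gen_a (map_poly emb G1) + smult gen_b (map_poly emb G2)"
  by (rule poly_eqI)
    (simp add: fhat_def f_def family2_def coeff_map_poly emb_def gen_a_def gen_b_def ratfun2_const_def)

lemma poly_fhat: "poly fhat x = g G0 x + gen_a * g G1 x + gen_b * g G2 x"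
  by (simp add: fhat_eq ev1_def)

lemma poly_fhat': "poly (pderiv fhat) x = g (pderiv G0) x + gen_a * g (pderiv G1) x + gen_b * g (pderiv G2) x"
proof -
  interpret field_hom_on UNIV emb by (rule ring_hm_imp_field_hom_on) (auto simp: ring_hm_emb)
  show ?thesis by (simp add: fhat_eq ev1_def map_poly_hom_pderiv pderiv_add pderiv_smult)
qed

lemma degree_fhat: "Polynomial.degree fhat = n" "fhat \<noteq> 0"
proof -
  have "Polynomial.coeff fhat n = 1"
    using deg_G0 deg_lt by (simp add: fhat_eq coeff_map_poly coeff_eq_0 ring_hmD[OF ring_hm_emb])
  moreover have "Polynomial.coeff fhat i = 0" if "i > n" for i
    using deg_G0 deg_lt that by (simp add: fhat_eq coeff_map_poly coeff_eq_0 ring_hmD[OF ring_hm_emb])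
  then have "Polynomial.degree fhat \<le> n" by (intro degree_le) auto
  ultimately show "Polynomial.degree fhat = n" "fhat \<noteq> 0"
    using le_degree[of fhat n] by auto
qed

lemma ac_roots_f: "ac_roots f = {x. poly fhat x = 0}"
  by (simp add: ac_roots_def fhat_def)

lemma finite_ac_roots: "finite (ac_roots f)"
  unfolding ac_roots_f by (rule poly_roots_finite) (rule degree_fhat)

lemma root_eq: "x \<in> ac_roots f \<Longrightarrow> g G0 x + gen_a * g G1 x + gen_b * g G2 x = 0"
  by (simp add: ac_roots_f poly_fhat)

text \<open>Were \<open>x\<close> algebraic over C(a), translating b would give a \<open>w\<close>
  with G2(w) = 0 and G0(w) + a G1(w) = 0. Then \<open>w\<close> is a constant, and since a is
  transcendental, \<open>w\<close> is a common root of the three polynomials.\<close>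

lemma indep_a_root:
  assumes x: "x \<in> ac_roots f"
  shows "indep emb gen_a x"
  unfolding indep_def
proof (intro allI impI, rule ccontr)
  note e = ring_hm_emb
  fix Q assume Q: "ev2 emb gen_a x Q = 0" "Q \<noteq> 0"
  define A where "A = lift_y G0 + smult [:0, 1:] (lift_y G1)"
  have A: "ev2 emb gen_a w A = g G0 w + gen_a * g G1 w" for w
    by (simp add: A_def ev2_arith e ev2_smult ev2_lift_y ev1_pCons ring_hmD(1)[OF e] ring_hmD(4)[OF e]
        ev1_const ring_hmD(1)[OF ring_hm_ev1])
  have "\<exists>w'. ev2 emb gen_a w' A = 0 \<and> ev2 emb gen_a w' (lift_y G2) = 0 \<and> (x \<noteq> gen_a \<longrightarrow> w' \<noteq> gen_a)"
    using root_eq[OF x]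
    by (intro algebraic_linear_relation[OF e indep_gen Q]) (simp add: A ev2_lift_y e)
  then obtain w where w: "g G0 w + gen_a * g G1 w = 0" "g G2 w = 0"
    by (auto simp: A ev2_lift_y e)
  obtain c where c: "w = emb c" "poly G2 c = 0" using ev1_root_complex[OF e w(2) G2_nz] by blast
  interpret field_hom_on UNIV emb by (rule ring_hm_imp_field_hom_on) (auto simp: e)
  have "g G w = emb (poly G c)" for G by (simp add: ev1_def c hom_poly)
  then have "ev1 emb gen_a [:poly G0 c, poly G1 c:] = 0"
    using w by (simp add: ev1_pCons e)
  then have "[:poly G0 c, poly G1 c:] = 0"
    using indep_imp_transc(1)[OF e indep_gen] by (auto simp: transc_def)
  then show False using no_common_root[of c] c(2) by simp
qed

lemma transc_root: "x \<in> ac_roots f \<Longrightarrow> transc emb x"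
  using indep_a_root indep_imp_transc ring_hm_emb by blast

text \<open>Eliminating b from f(x) = f'(x) = 0 leaves A(x) + a B(x) = 0. Independence of a and x
  forces B = 0, against \<open>minor_nz\<close>.\<close>

lemma separable:
  assumes x: "x \<in> ac_roots f"
  shows "poly (pderiv fhat) x \<noteq> 0"
proof
  note e = ring_hm_emb
  note ea = ring_hmD[OF ring_hm_ev1[OF e]]
  assume "poly (pderiv fhat) x = 0"
  then have 1: "g (pderiv G0) x + gen_a * g (pderiv G1) x + gen_b * g (pderiv G2) x = 0"
    by (simp add: poly_fhat')
  define A where "A = pderiv G0 * G2 - G0 * pderiv G2"
  define B where "B = pderiv G1 * G2 - G1 * pderiv G2"
  have "g A x + gen_a * g B x = (g (pderiv G0) x + gen_a * g (pderiv G1) x + gen_b * g (pderiv G2) x) * g G2 x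
     - (g G0 x + gen_a * g G1 x + gen_b * g G2 x) * g (pderiv G2) x"
    by (simp add: A_def B_def ea algebra_simps)
  then have "g A x + gen_a * g B x = 0" using 1 root_eq[OF x] by simp
  then have "ev2 emb gen_a x (lift_y A + smult [:0, 1:] (lift_y B)) = 0"
    by (simp add: ev2_arith e ev2_smult ev2_lift_y ev1_pCons ring_hmD(1,4)[OF e] ev1_const ea(1))
  then have "lift_y A + smult [:0, 1:] (lift_y B) = 0"
    using indep_a_root[OF x] by (simp add: indep_def)
  then have "Polynomial.coeff (lift_y A + smult [:0, 1:] (lift_y B)) i = 0" for i by simp
  then have "[:Polynomial.coeff A i, Polynomial.coeff B i:] = 0" for i
    by (simp add: coeff_lift_y)
  then have "B = 0" by (intro poly_eqI) simp
  then show False using minor_nz by (simp add: B_def)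
qed

lemma card_ac_roots: "card (ac_roots f) = n"
  unfolding ac_roots_f degree_fhat(1)[symmetric]
  by (rule card_roots_alg_closed) (use separable degree_fhat in \<open>auto simp: ac_roots_f\<close>)

lemma rel:
  assumes "x \<in> ac_roots f" "y \<in> ac_roots f"
  shows "(g G0 y * g G2 x - g G0 x * g G2 y) + gen_a * (g G1 y * g G2 x - g G1 x * g G2 y) = 0"
proof -
  have "(g G0 y * g G2 x - g G0 x * g G2 y) + gen_a * (g G1 y * g G2 x - g G1 x * g G2 y)
    = (g G0 y + gen_a * g G1 y + gen_b * g G2 y) * g G2 x - (g G0 x + gen_a * g G1 x + gen_b * g G2 x) * g G2 y"
    by (simp add: algebra_simps)
  then show ?thesis using assms root_eq by simp
qed

text \<open>If this minor vanished, \<open>rel\<close> would make the second one vanish too, and the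
  vectors at \<open>x\<close> and \<open>y\<close> would be parallel.\<close>

lemma det_nz:
  assumes "x \<in> ac_roots f" "y \<in> ac_roots f" "x \<noteq> y"
  shows "g G1 y * g G2 x - g G1 x * g G2 y \<noteq> 0"
  using rel[OF assms(1,2)] not_parallel[OF transc_root[OF assms(1)], of y] assms(3) by auto

text \<open>\<open>rel\<close> is linear in a, which is independent of \<open>x\<close>. Were
  \<open>y\<close> algebraic over C(x), translating a would give a \<open>w'\<close> at which both
  minors vanish. That \<open>w'\<close> differs from \<open>x\<close> is essential: at
  \<open>x\<close> itself both minors vanish trivially.\<close>

lemma indep_roots:
  assumes x: "x \<in> ac_roots f" and y: "y \<in> ac_roots f" and "x \<noteq> y"
  shows "indep emb x y"
  unfolding indep_def
proof (intro allI impI, rule ccontr)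
  note e = ring_hm_emb
  fix Q assume Q: "ev2 emb x y Q = 0" "Q \<noteq> 0"
  define A where "A = lift_y G0 * [:G2:] - [:G0:] * lift_y G2"
  define B where "B = lift_y G1 * [:G2:] - [:G1:] * lift_y G2"
  have A: "ev2 emb x w A = g G0 w * g G2 x - g G0 x * g G2 w"
    and B: "ev2 emb x w B = g G1 w * g G2 x - g G1 x * g G2 w" for w
    unfolding A_def B_def by (simp_all only: ev2_arith[OF e] ev2_lift_y[OF e] ev2_const[OF e])
  have "\<exists>w'. ev2 emb x w' A = 0 \<and> ev2 emb x w' B = 0 \<and> (y \<noteq> x \<longrightarrow> w' \<noteq> x)"
    using rel[OF x y]
    by (intro algebraic_linear_relation[OF e indep_swap[OF e indep_a_root[OF x]] Q]) (simp add: A B)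
  then show False
    using not_parallel[OF transc_root[OF x]] \<open>x \<noteq> y\<close> by (auto simp: A B)
qed

lemma gen_mem:
  assumes F: "subfld F" "range emb \<subseteq> F" and xy: "x \<in> F" "y \<in> F" "x \<in> ac_roots f" "y \<in> ac_roots f" "x \<noteq> y"
  shows "gen_a \<in> F" "gen_b \<in> F" "range to_ac \<subseteq> F"
proof -
  have G: "g G z \<in> F" if "z \<in> F" for G z
    using hom_ev1[of F "\<lambda>x. x" emb emb z G] F ring_hm_emb that
    by (auto intro: field_hom_on_id)
  note L = linear_system_unique[OF root_eq[OF xy(3)] root_eq[OF xy(4)] det_nz[OF xy(3,4,5)]]
  show "gen_a \<in> F" "gen_b \<in> F" using L G xy subfldD[OF F(1)] by metis+
  then show "range to_ac \<subseteq> F" using range_to_ac_subset F by blast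
qed

lemma fhat_over: "range to_ac \<subseteq> F \<Longrightarrow> fhat \<in> polys_over F"
  by (auto simp: polys_over_def fhat_def coeff_map_poly)

end

section \<open>Simple roots over power series\<close>

lemma poly_taylor2:
  fixes p :: "'a::idom poly"
  shows "\<exists>R. poly p (y + h) = poly p y + h * poly (pderiv p) y + h\<^sup>2 * R"
proof (induction p)
  case 0
  show ?case by simp
next
  case (pCons a p)
  then obtain R where R: "poly p (y + h) = poly p y + h * poly (pderiv p) y + h\<^sup>2 * R" by blast
  have "poly (pCons a p) (y + h) = poly (pCons a p) y + h * poly (pderiv (pCons a p)) y
      + h\<^sup>2 * (y * R + poly (pderiv p) y + h * R)"
    by (simp only: poly_pCons R pderiv_pCons poly_add) (simp add: algebra_simps power2_eq_square)
  then show ?case by blast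
qed

definition const_term :: "'a::field fps \<Rightarrow> 'a" where "const_term y = y $ 0"

lemma ring_hm_const_term: "ring_hm const_term"
  by (simp add: ring_hm_def const_term_def)

lemma const_term_poly: "poly P y $ 0 = poly (map_poly const_term P) (y $ 0)"
proof (induction P)
  case (pCons a P)
  then show ?case by (simp add: map_poly_pCons ring_hmD[OF ring_hm_const_term]) (simp add: const_term_def)
qed simp

lemma map_poly_pderiv_ring_hm:
  fixes e :: "'a::idom \<Rightarrow> 'b::idom"
  assumes "ring_hm e"
  shows "map_poly e (pderiv P) = pderiv (map_poly e P)"
  by (rule poly_eqI)
    (simp only: coeff_map_poly coeff_pderiv ring_hmD[OF assms] map_poly_pCons)

lemma const_term_poly_pderiv: "poly (pderiv P) y $ 0 = poly (pderiv (map_poly const_term P)) (y $ 0)"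
  by (simp add: const_term_poly map_poly_pderiv_ring_hm ring_hm_const_term)

lemma fps_X_power_dvd: "(\<forall>i<k. (f :: 'a::field fps) $ i = 0) \<longleftrightarrow> (\<exists>g. f = fps_X ^ k * g)"
proof
  assume a: "\<forall>i<k. f $ i = 0"
  have "f = fps_X ^ k * fps_shift k f"
    by (rule fps_ext) (use a in \<open>auto simp: fps_X_power_mult_nth\<close>)
  then show "\<exists>g. f = fps_X ^ k * g" by blast
qed (auto simp: fps_X_power_mult_nth)

text \<open>Hensel's lemma, lifting one coefficient at a time.\<close>

theorem fps_root_exists:
  fixes P :: "'a::field fps poly"
  assumes r: "poly (map_poly const_term P) r = 0" "poly (pderiv (map_poly const_term P)) r \<noteq> 0"
  shows "\<exists>y. poly P y = 0 \<and> y $ 0 = r"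
proof -
  \<comment> \<open>Stage k is a root up to and including degree k, and stage k + 1 changes no
    coefficient of degree at most k.\<close>
  have "\<exists>Y. \<forall>k. (Y k $ 0 = r \<and> (\<forall>i<Suc k. poly P (Y k) $ i = 0)) \<and> (\<forall>i<Suc k. Y (Suc k) $ i = Y k $ i)"
  proof (rule dependent_nat_choice)
    show "\<exists>y. y $ 0 = r \<and> (\<forall>i<Suc 0. poly P y $ i = 0)"
      using r by (intro exI[of _ "fps_const r"]) (simp add: const_term_poly)
  next
    fix y k assume y: "y $ 0 = r \<and> (\<forall>i<Suc k. poly P y $ i = 0)"
    define D where "D = poly (pderiv P) y"
    have D0: "D $ 0 \<noteq> 0" using r y by (simp add: D_def const_term_poly_pderiv)
    \<comment> \<open>The value for which the coefficient of degree k + 1 of P(y) + h P'(y)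
      vanishes; the quadratic Taylor term only starts at degree 2k + 2.\<close>
    define c where "c = - (poly P y $ Suc k) / D $ 0"
    define h where "h = fps_X ^ Suc k * fps_const c"
    obtain R where R: "poly P (y + h) = poly P y + h * D + h\<^sup>2 * R" using poly_taylor2 unfolding D_def by blast
    have hi: "(h * g) $ i = (if i < Suc k then 0 else c * g $ (i - Suc k))" for g i
      by (simp add: h_def mult.assoc fps_X_power_mult_nth del: power_Suc)
    have "h $ 0 = 0" using hi[of 1 0] by simp
    then have h2: "(h\<^sup>2 * R) $ i = 0" if "i \<le> Suc k" for i
      using that by (simp add: power2_eq_square mult.assoc hi)
    have "poly P (y + h) $ i = 0" if "i < Suc (Suc k)" for i
    proof (cases "i = Suc k")
      case True
      then show ?thesis using D0 by (simp add: R h2 hi c_def)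
    next
      case False
      then show ?thesis using that y by (simp add: R h2 hi)
    qed
    moreover have "(y + h) $ i = y $ i" if "i < Suc k" for i
      using hi[of 1 i] that by simp
    ultimately show "\<exists>y'. (y' $ 0 = r \<and> (\<forall>i<Suc (Suc k). poly P y' $ i = 0)) \<and> (\<forall>i<Suc k. y' $ i = y $ i)"
      using y by (intro exI[of _ "y + h"]) auto
  qed
  then obtain Y where Y: "\<And>k. Y k $ 0 = r" "\<And>k i. i \<le> k \<Longrightarrow> poly P (Y k) $ i = 0"
    "\<And>k i. i \<le> k \<Longrightarrow> Y (Suc k) $ i = Y k $ i" by (auto simp: less_Suc_eq_le)
  \<comment> \<open>The limit of the stages: coefficient i no longer changes from stage i
    on.\<close>
  define y where "y = Abs_fps (\<lambda>i. Y i $ i)"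
  have stable: "Y k $ i = Y i $ i" if "i \<le> k" for i k
    using that by (induction k rule: dec_induct) (auto simp: Y)
  have "poly P y $ k = 0" for k
  proof -
    have "\<forall>i<Suc k. (y - Y k) $ i = 0"
    proof (intro allI impI)
      fix i assume "i < Suc k"
      then have "Y k $ i = Y i $ i" by (intro stable) simp
      then show "(y - Y k) $ i = 0" by (simp add: y_def)
    qed
    then obtain g where "y - Y k = fps_X ^ Suc k * g" using fps_X_power_dvd[of "Suc k" "y - Y k"] by blast
    then have g: "y = Y k + fps_X ^ Suc k * g" by (simp only: diff_eq_eq add.commute)
    define h where "h = fps_X ^ Suc k * g"
    have z: "(h * q) $ k = 0" for q by (simp add: h_def mult.assoc fps_X_power_mult_nth del: power_Suc)
    obtain R where "poly P y = poly P (Y k) + h * poly (pderiv P) (Y k) + h\<^sup>2 * R"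
      using poly_taylor2[of P "Y k" h] g by (auto simp: h_def)
    then show ?thesis using z Y(2) by (simp add: power2_eq_square mult.assoc)
  qed
  then have "poly P y = 0" by (intro fps_ext) simp
  moreover have "y $ 0 = r" by (simp add: y_def Y)
  ultimately show ?thesis by blast
qed

text \<open>By Taylor expansion the difference h of the roots satisfies h (P'(y) + h R) = 0. Since h
  has zero constant term, the second factor has the nonzero constant term of P'(y).\<close>

lemma fps_root_unique:
  fixes P :: "'a::field fps poly"
  assumes "poly P y = 0" "poly P y' = 0" "y' $ 0 = y $ 0"
    and r: "poly (pderiv (map_poly const_term P)) (y $ 0) \<noteq> 0"
  shows "y' = y"
proof -
  define h where "h = y' - y"
  obtain R where "poly P (y + h) = poly P y + h * poly (pderiv P) y + h\<^sup>2 * R" using poly_taylor2 by blast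
  then have "h * (poly (pderiv P) y + h * R) = 0"
    using assms by (simp add: h_def power2_eq_square algebra_simps)
  moreover have "(poly (pderiv P) y + h * R) $ 0 \<noteq> 0"
    using r assms by (simp add: const_term_poly_pderiv h_def)
  then have "poly (pderiv P) y + h * R \<noteq> 0" by (metis fps_zero_nth)
  ultimately show ?thesis by (auto simp: h_def)
qed

section \<open>The sign change of the power series variable\<close>

definition fps_flip :: "'a::field fps \<Rightarrow> 'a fps" where "fps_flip y = y oo (- fps_X)"

lemma fps_flip_nth: "fps_flip y $ k = (-1) ^ k * y $ k"
  by (simp add: fps_flip_def fps_compose_uminus')

lemma ring_hm_fps_flip: "ring_hm fps_flip"
  by (simp add: ring_hm_def fps_flip_def fps_compose_add_distrib fps_compose_mult_distrib)

lemma fps_flip_const [simp]: "fps_flip (fps_const c) = fps_const c"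
  by (simp add: fps_flip_def)

lemma fps_flip_inverse:
  assumes "fps_flip y = y" "y $ 0 \<noteq> 0"
  shows "fps_flip (inverse y) = inverse y"
proof -
  have "fps_flip (inverse y) * y = fps_flip (inverse y * y)"
    using assms(1) by (simp add: ring_hmD(3)[OF ring_hm_fps_flip])
  also have "\<dots> = inverse y * y"
    using inverse_mult_eq_1[OF assms(2)] ring_hmD(1)[OF ring_hm_fps_flip] by simp
  finally show ?thesis using assms(2) by (auto simp: mult_cancel_right)
qed

text \<open>The flip of a root is a root with the same constant term, so uniqueness of the lift
  makes it the same root.\<close>

lemma fps_flip_root:
  assumes "poly P y = 0" "map_poly fps_flip P = P"
    and "poly (pderiv (map_poly const_term P)) (y $ 0) \<noteq> 0"
  shows "fps_flip y = y"
proof (rule fps_root_unique[OF assms(1) _ _ assms(3)])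
  have "fps_flip (poly P y) = poly (map_poly fps_flip P) (fps_flip y)"
    by (induction P) (auto simp: map_poly_pCons ring_hmD[OF ring_hm_fps_flip])
  then show "poly P (fps_flip y) = 0" using assms by (simp add: ring_hmD[OF ring_hm_fps_flip])
qed (simp add: fps_flip_nth)

definition fls_flip :: "'a::field fls \<Rightarrow> 'a fls" where "fls_flip y = fls_compose_fps y (- fps_X)"

lemma ring_hm_fls_flip: "ring_hm fls_flip"
  by (simp add: ring_hm_def fls_flip_def fls_compose_fps_add fls_compose_fps_mult)

lemma fls_flip_fps_to_fls: "fls_flip (fps_to_fls y) = fps_to_fls (fps_flip y)"
  by (simp add: fls_flip_def fps_flip_def)

lemma ring_hm_fps_to_fls: "ring_hm fps_to_fls"
  by (simp add: ring_hm_def fls_times_fps_to_fls)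

text \<open>With \<open>m\<close> the minimal equation of \<open>r\<close> over \<open>k(z)\<close> and \<open>c F = m q\<close>, both \<open>m\<close> and \<open>q\<close> vanish at \<open>r\<close>;
  hence so does every derivative of their product.\<close>
theorem double_root_param_derivative:
  fixes e :: "'k::field_char_0 \<Rightarrow> 'a::field" and FF :: "'k poly poly"
  assumes e: "ring_hm e" and z: "transc e z" and FF: "FF \<noteq> 0"
    and root: "ev2 e z r FF = 0" "ev2 e z r (pderiv FF) = 0"
  shows "ev2 e z r (map_poly pderiv FF) = 0"
proof -
  have dz: "map_poly pderiv (P * Q) = map_poly pderiv P * Q + P * map_poly pderiv Q" for P Q :: "'k poly poly"
  proof (rule poly_eqI)
    fix i
    have s: "pderiv (sum h I) = (\<Sum>i\<in>I. pderiv (h i))" for h :: "nat \<Rightarrow> 'k poly" and I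
      using higher_pderiv_sum[of 1] by simp
    show "Polynomial.coeff (map_poly pderiv (P * Q)) i =
      Polynomial.coeff (map_poly pderiv P * Q + P * map_poly pderiv Q) i"
      by (simp only: coeff_map_poly[of pderiv, OF pderiv_0] coeff_add coeff_mult s pderiv_mult sum.distrib)
        (simp add: mult.commute)
  qed
  note E = ev2_arith[OF e]
  define m where "m = arg_min Polynomial.degree (\<lambda>P. P \<noteq> 0 \<and> ev2 e z r P = 0)"
  have m: "m \<noteq> 0" "ev2 e z r m = 0"
    and min: "\<And>P. P \<noteq> 0 \<Longrightarrow> ev2 e z r P = 0 \<Longrightarrow> Polynomial.degree m \<le> Polynomial.degree P"
    unfolding m_def using arg_min_natI[of "\<lambda>P. P \<noteq> 0 \<and> ev2 e z r P = 0" FF Polynomial.degree]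
      arg_min_nat_le[of "\<lambda>P. P \<noteq> 0 \<and> ev2 e z r P = 0" _ Polynomial.degree] FF root(1) by auto
  have deg: "Polynomial.degree m > 0"
  proof (rule ccontr)
    assume "\<not> ?thesis"
    then obtain c where c: "m = [:c:]" by (metis degree_eq_zeroE gr0I)
    then have "ev1 e z c = 0" using m(2) e by (simp add: ev2_const)
    then show False using z m(1) c by (simp add: transc_def)
  qed
  have m': "ev2 e z r (pderiv m) \<noteq> 0"
  proof
    assume "ev2 e z r (pderiv m) = 0"
    moreover have "pderiv m \<noteq> 0" using deg by (simp add: pderiv_eq_0_iff)
    ultimately show False using min[of "pderiv m"] deg by (simp add: degree_pderiv)
  qed
  \<comment> \<open>Pseudo-division stays in k[z][X] at the price of a power \<open>c\<close> of the
    leading coefficient of \<open>m\<close>, which is nonzero at the transcendental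
    \<open>z\<close>.\<close>
  obtain q t where qt: "pseudo_divmod FF m = (q, t)" by (cases "pseudo_divmod FF m")
  define c where "c = Polynomial.coeff m (Polynomial.degree m) ^ (Suc (Polynomial.degree FF) - Polynomial.degree m)"
  have c0: "c \<noteq> 0" using m(1) by (simp add: c_def)
  have div: "smult c FF = m * q + t" "t = 0 \<or> Polynomial.degree t < Polynomial.degree m"
    using pseudo_divmod[OF m(1) qt] by (simp_all add: c_def)
  have "ev2 e z r t = 0"
    using arg_cong[OF div(1), of "ev2 e z r"] m(2) root(1) by (simp add: E ev2_smult e)
  then have "t = 0" using min[of t] div(2) by force
  then have eq: "smult c FF = m * q" using div(1) by simp
  \<comment> \<open>Differentiating \<open>smult c FF = m * q\<close> in the outer variable at
    \<open>r\<close> leaves only this term; minimality of \<open>m\<close> keeps its first factor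
    nonzero.\<close>
  have "ev2 e z r (pderiv m) * ev2 e z r q = 0"
    using arg_cong[OF eq, of "\<lambda>P. ev2 e z r (pderiv P)"] root(2) m(2)
    by (auto simp: pderiv_smult pderiv_mult E ev2_smult e)
  then have q: "ev2 e z r q = 0" using m' by simp
  have "map_poly pderiv (smult c FF) = smult (pderiv c) FF + smult c (map_poly pderiv FF)"
    by (rule poly_eqI) (simp add: coeff_map_poly pderiv_mult algebra_simps)
  then have "ev1 e z c * ev2 e z r (map_poly pderiv FF) = 0"
    using arg_cong[OF eq, of "\<lambda>P. ev2 e z r (map_poly pderiv P)"] m(2) q root(1)
    by (simp add: dz E ev2_smult e)
  then show ?thesis using c0 z by (auto simp: transc_def)
qed

section \<open>Transpositions of roots\<close>

lemma ring_hm_fps_const: "ring_hm fps_const"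
  by (simp add: ring_hm_def)

lemma ring_hm_poly_arg: "ring_hm h \<Longrightarrow> h (poly p x) = poly (map_poly h p) (h x)"
  by (induction p) (auto simp: map_poly_pCons ring_hmD)

lemma ring_hm_ev1_arg: "ring_hm e \<Longrightarrow> ring_hm h \<Longrightarrow> h (ev1 e x p) = ev1 (\<lambda>c. h (e c)) (h x) p"
  by (simp add: ev1_def ring_hm_poly_arg map_poly_map_poly ring_hmD o_def)

lemma ev1_fps_expansion:
  fixes e :: "complex \<Rightarrow> 'a::field"
  assumes e: "ring_hm e"
  shows "ev1 (\<lambda>c. fps_const (e c)) (fps_const z + fps_const d * fps_X) G $ 0 = ev1 e z G"
    and "ev1 (\<lambda>c. fps_const (e c)) (fps_const z + fps_const d * fps_X) G $ 1 = d * ev1 e z (pderiv G)"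
proof -
  let ?e = "\<lambda>c. fps_const (e c)"
  have e': "ring_hm ?e" by (rule ring_hm_comp[OF e ring_hm_fps_const])
  obtain R where R: "poly (map_poly ?e G) (fps_const z + fps_const d * fps_X) = poly (map_poly ?e G) (fps_const z)
     + (fps_const d * fps_X) * poly (pderiv (map_poly ?e G)) (fps_const z) + (fps_const d * fps_X)\<^sup>2 * R"
    using poly_taylor2 by blast
  have c: "ev1 ?e (fps_const z) p = fps_const (ev1 e z p)" for p
    using ring_hm_ev1_arg[OF e ring_hm_fps_const] by metis
  have "ev1 ?e (fps_const z + fps_const d * fps_X) G = fps_const (ev1 e z G)
     + fps_const d * (fps_X * fps_const (ev1 e z (pderiv G))) + fps_const (d\<^sup>2) * (fps_X ^ 2 * R)"
    using R by (simp add: ev1_def[of ?e, symmetric] map_poly_pderiv_ring_hm[OF e', symmetric] c power_mult_distrib mult.assoc)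
  then show "ev1 ?e (fps_const z + fps_const d * fps_X) G $ 0 = ev1 e z G"
    "ev1 ?e (fps_const z + fps_const d * fps_X) G $ 1 = d * ev1 e z (pderiv G)"
    by (simp_all add: fps_X_power_mult_nth)
qed

text \<open>A relation between z and s is a polynomial in s over k[z]. Vanishing as a Laurent series
  kills each coefficient, and z is transcendental; passing to z + s and z - s is an invertible
  substitution.\<close>

lemma indep_fls:
  fixes e :: "complex \<Rightarrow> 'a::field"
  assumes e: "ring_hm e" "transc e z"
  shows "indep (\<lambda>c. fls_const (e c)) (fls_const z + fls_X) (fls_const z - fls_X)"
proof (rule indep_sum_diff)
  have c: "ring_hm (fls_const :: 'a \<Rightarrow> _)" by (simp add: ring_hm_def fls_plus_const fls_const_mult_const)
  show e': "ring_hm (\<lambda>c. fls_const (e c))" by (rule ring_hm_comp[OF e(1) c])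
  show "indep (\<lambda>c. fls_const (e c)) (fls_const z) fls_X"
    unfolding indep_def
  proof (intro allI impI)
    fix P assume P: "ev2 (\<lambda>c. fls_const (e c)) (fls_const z) fls_X P = 0"
    have *: "poly (map_poly fls_const p) fls_X = fps_to_fls (fps_of_poly p)" for p :: "'a poly"
      by (induction p) (auto simp: map_poly_pCons fps_of_poly_pCons fls_times_fps_to_fls mult.commute)
    have "ev2 (\<lambda>c. fls_const (e c)) (fls_const z) fls_X P = poly (map_poly fls_const (map_poly (ev1 e z) P)) fls_X"
      by (simp add: ev2_def map_poly_map_poly ring_hmD[OF ring_hm_ev1[OF e(1)]] o_def ring_hm_ev1_arg[OF e(1) c])
    then have "map_poly (ev1 e z) P = 0" using P by (simp add: *)
    then have "ev1 e z (Polynomial.coeff P i) = 0" for i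
      by (metis coeff_0 coeff_map_poly ev1_0)
    then show "P = 0" using e(2) by (auto simp: transc_def intro: poly_eqI)
  qed
qed

text \<open>R is orthogonal to g x d and g x s. As det(g, d, s) is nonzero, these span the plane
  orthogonal to g, so R is parallel to g; the conclusion lists two components of R x g.\<close>

lemma cross_product_parallel:
  fixes R0 R1 R2 g0 g1 g2 d0 d1 d2 s0 s1 s2 :: "'a::field"
  assumes "R0 * (g1 * d2 - g2 * d1) + R1 * (g2 * d0 - g0 * d2) + R2 * (g0 * d1 - g1 * d0) = 0"
    and "R0 * (g1 * s2 - g2 * s1) + R1 * (g2 * s0 - g0 * s2) + R2 * (g0 * s1 - g1 * s0) = 0"
    and "g0 * (d1 * s2 - s1 * d2) + g1 * (d2 * s0 - s2 * d0) + g2 * (d0 * s1 - s0 * d1) \<noteq> 0" (is "?W \<noteq> 0")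
  shows "R1 * g2 - g1 * R2 = 0" "R0 * g2 - g0 * R2 = 0"
proof -
  let ?m = "R0 * (g1 * d2 - g2 * d1) + R1 * (g2 * d0 - g0 * d2) + R2 * (g0 * d1 - g1 * d0)"
  let ?n = "R0 * (g1 * s2 - g2 * s1) + R1 * (g2 * s0 - g0 * s2) + R2 * (g0 * s1 - g1 * s0)"
  have "?W * (R1 * g2 - g1 * R2) = (g1 * d2 - g2 * d1) * ?n - (g1 * s2 - g2 * s1) * ?m"
    by (simp add: algebra_simps)
  then show "R1 * g2 - g1 * R2 = 0" using assms by simp
  have "?W * (R0 * g2 - g0 * R2) = (g2 * s0 - g0 * s2) * ?m - (g2 * d0 - g0 * d2) * ?n"
    by (simp add: algebra_simps)
  then show "R0 * g2 - g0 * R2 = 0" using assms by simp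
qed

lemma two_ratfun_closure [simp]: "(2 :: ratfun_closure) \<noteq> 0"
proof -
  have "emb 2 = 2" using ring_hmD(7)[OF ring_hm_emb, of 2] by simp
  then show ?thesis using ring_hm_eq_iff(2)[OF ring_hm_emb, of 2] by simp
qed

section \<open>The pencil around its member with a double root at z\<close>

context generic_pencil
begin

text \<open>K is the closure of C(a, b) once more, and \<open>gen_a\<close> merely a convenient
  transcendental element of it; this \<open>z\<close> is unrelated to the role of a as a coefficient
  of f.\<close>

abbreviation z :: ratfun_closure where "z \<equiv> gen_a"

lemma transc_z: "transc emb z"
  using indep_imp_transc(1)[OF ring_hm_emb indep_gen] .

lemma g_nz: "p \<noteq> 0 \<Longrightarrow> g p z \<noteq> 0"
  using transc_z by (auto simp: transc_def)

lemmas g_arith = ring_hmD[OF ring_hm_ev1[OF ring_hm_emb]]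

text \<open>The coefficients in \<open>z\<close> are those of the member of the family with a double root at \<open>z\<close>.\<close>
lemma tangent_simple_root:
  assumes "r \<noteq> z"
    and "g G0 r * g (G1 * pderiv G2 - G2 * pderiv G1) z + g G1 r * g (G2 * pderiv G0 - G0 * pderiv G2) z
       + g G2 r * g (G0 * pderiv G1 - G1 * pderiv G0) z = 0"
    and d: "g (pderiv G0) r * g (G1 * pderiv G2 - G2 * pderiv G1) z
       + g (pderiv G1) r * g (G2 * pderiv G0 - G0 * pderiv G2) z
       + g (pderiv G2) r * g (G0 * pderiv G1 - G1 * pderiv G0) z = 0"
  shows False
proof -
  note e = ring_hm_emb
  \<comment> \<open>(m0, m1, m2) is the cross product of G = (G0, G1, G2) and G'. As coefficients it
    gives the member with a double root at z, cleared of denominators.\<close>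
  define m0 where "m0 = G1 * pderiv G2 - G2 * pderiv G1"
  define m1 where "m1 = G2 * pderiv G0 - G0 * pderiv G2"
  define m2 where "m2 = G0 * pderiv G1 - G1 * pderiv G0"
  define FF where "FF = lift_y G0 * [:m0:] + lift_y G1 * [:m1:] + lift_y G2 * [:m2:]"
  have coeff: "Polynomial.coeff FF i = smult (Polynomial.coeff G0 i) m0 + smult (Polynomial.coeff G1 i) m1
     + smult (Polynomial.coeff G2 i) m2" for i
    by (simp add: FF_def mult.commute[of "lift_y _"] coeff_lift_y mult.commute[of m0] mult.commute[of m1] mult.commute[of m2])
  have "m0 \<noteq> 0" using minor_nz by (simp add: m0_def algebra_simps)
  moreover have "Polynomial.coeff FF n = m0" 
    using deg_G0 deg_lt by (simp add: coeff coeff_eq_0)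
  ultimately have "FF \<noteq> 0" by auto
  have "pderiv FF = lift_y (pderiv G0) * [:m0:] + lift_y (pderiv G1) * [:m1:] + lift_y (pderiv G2) * [:m2:]"
    by (rule poly_eqI)
      (simp add: coeff coeff_pderiv mult.commute[of "lift_y _"] coeff_lift_y mult.commute[of m0] mult.commute[of m1]
        mult.commute[of m2] of_nat_poly smult_add_right algebra_simps)
  moreover have "map_poly pderiv FF = lift_y G0 * [:pderiv m0:] + lift_y G1 * [:pderiv m1:] + lift_y G2 * [:pderiv m2:]"
    by (rule poly_eqI)
      (simp add: coeff_map_poly coeff mult.commute[of "lift_y _"] coeff_lift_y mult.commute[of "pderiv _"]
        pderiv_add pderiv_smult)
  ultimately have ev: "ev2 emb z r FF = g G0 r * g m0 z + g G1 r * g m1 z + g G2 r * g m2 z"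
     "ev2 emb z r (pderiv FF) = g (pderiv G0) r * g m0 z + g (pderiv G1) r * g m1 z + g (pderiv G2) r * g m2 z"
     "ev2 emb z r (map_poly pderiv FF) = g G0 r * g (pderiv m0) z + g G1 r * g (pderiv m1) z + g G2 r * g (pderiv m2) z"
    unfolding FF_def by (simp_all only: ev2_arith[OF e] ev2_lift_y[OF e] ev2_const[OF e])
  have 0: "ev2 emb z r FF = 0" "ev2 emb z r (pderiv FF) = 0"
    using assms by (simp_all add: ev m0_def m1_def m2_def)
  have 1: "g G0 r * g (pderiv m0) z + g G1 r * g (pderiv m1) z + g G2 r * g (pderiv m2) z = 0"
    using double_root_param_derivative[OF e transc_z \<open>FF \<noteq> 0\<close> 0] ev by simp
  \<comment> \<open>The derivative of G x G' is G x G''. Hence G(r) is orthogonal to both products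
    at z and so parallel to G(z): this is the biduality step.\<close>
  have pm: "pderiv m0 = G1 * pderiv (pderiv G2) - G2 * pderiv (pderiv G1)"
      "pderiv m1 = G2 * pderiv (pderiv G0) - G0 * pderiv (pderiv G2)"
      "pderiv m2 = G0 * pderiv (pderiv G1) - G1 * pderiv (pderiv G0)"
    by (simp_all add: m0_def m1_def m2_def pderiv_diff pderiv_mult)
  have "g G1 r * g G2 z - g G1 z * g G2 r = 0" "g G0 r * g G2 z - g G0 z * g G2 r = 0"
    using cross_product_parallel[of "g G0 r" "g G1 z" "g (pderiv G2) z" "g G2 z" "g (pderiv G1) z" "g G1 r"
       "g (pderiv G0) z" "g G0 z" "g G2 r" "g (pderiv (pderiv G2)) z" "g (pderiv (pderiv G1)) z"
       "g (pderiv (pderiv G0)) z"]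
      0(1)[unfolded ev] 1[unfolded pm] g_nz[OF wronskian_nz]
    by (simp_all add: m0_def m1_def m2_def g_arith)
  then show False using not_parallel[OF transc_z assms(1)] by blast
qed

text \<open>\<open>gp G\<close> is the even part of \<open>G(z + s)\<close> and \<open>gm G\<close> its odd part divided by \<open>s\<close>; \<open>as\<close> and \<open>bs\<close> are the
  values of \<open>a\<close> and \<open>b\<close> for which \<open>z + s\<close> and \<open>z - s\<close> are roots.\<close>
definition es :: "complex \<Rightarrow> ratfun_closure fps" where "es c = fps_const (emb c)"
definition xs :: "ratfun_closure fps" where "xs = fps_const z + fps_X"
definition ys :: "ratfun_closure fps" where "ys = fps_const z - fps_X"
definition gp :: "complex poly \<Rightarrow> ratfun_closure fps" where
  "gp G = fps_const (1/2) * (ev1 es xs G + ev1 es ys G)"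
definition gm :: "complex poly \<Rightarrow> ratfun_closure fps" where
  "gm G = fps_shift 1 (fps_const (1/2) * (ev1 es xs G - ev1 es ys G))"
text \<open>The determinant formed from \<open>xs\<close> and \<open>ys\<close> themselves vanishes
  at s = 0. Even and odd parts, the latter divided by s, give a determinant with constant term G1
  G2' - G2 G1' at z, hence a unit.\<close>

definition A0 :: "ratfun_closure fps" where "A0 = gp G1 * gm G2 - gp G2 * gm G1"
definition as :: "ratfun_closure fps" where "as = (gp G2 * gm G0 - gp G0 * gm G2) * inverse A0"
definition bs :: "ratfun_closure fps" where "bs = (gp G0 * gm G1 - gp G1 * gm G0) * inverse A0"
definition h :: "ratfun_closure fps poly" where
  "h = map_poly es G0 + smult as (map_poly es G1) + smult bs (map_poly es G2)"
definition hbar :: "ratfun_closure poly" where "hbar = map_poly const_term h"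

lemma ring_hm_es: "ring_hm es"
  unfolding es_def[abs_def] by (rule ring_hm_comp[OF ring_hm_emb ring_hm_fps_const])

lemma ev1_xs_ys:
  "ev1 es xs G $ 0 = g G z" "ev1 es xs G $ Suc 0 = g (pderiv G) z"
  "ev1 es ys G $ 0 = g G z" "ev1 es ys G $ Suc 0 = - g (pderiv G) z"
  using ev1_fps_expansion[OF ring_hm_emb, of z 1 G] ev1_fps_expansion[OF ring_hm_emb, of z "-1" G]
  by (simp_all add: xs_def ys_def es_def[abs_def] fps_const_neg[symmetric] del: fps_const_neg)

lemma ev1_xs_eq: "ev1 es xs G = gp G + fps_X * gm G" "ev1 es ys G = gp G - fps_X * gm G"
proof -
  have "fps_X * gm G = fps_const (1/2) * (ev1 es xs G - ev1 es ys G)"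
    by (rule fps_ext) (auto simp: gm_def ev1_xs_ys split: nat.split)
  moreover have "fps_const (1/2) * u + fps_const (1/2) * u = u" for u :: "ratfun_closure fps"
    by (simp flip: distrib_right fps_const_add)
  then have "fps_const (1/2) * (u + v) + fps_const (1/2) * (u - v) = u"
    "fps_const (1/2) * (u + v) - fps_const (1/2) * (u - v) = v" for u v :: "ratfun_closure fps"
    by (simp_all add: algebra_simps)
  ultimately show "ev1 es xs G = gp G + fps_X * gm G" "ev1 es ys G = gp G - fps_X * gm G"
    by (simp_all add: gp_def)
qed

lemma gp_gm_0: "gp G $ 0 = g G z" "gm G $ 0 = g (pderiv G) z"
  by (simp_all add: gp_def gm_def ev1_xs_ys)

lemma flip_ev1: "fps_flip (ev1 es xs G) = ev1 es ys G"
proof -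
  have "fps_flip xs = ys" by (rule fps_ext) (auto simp: fps_flip_nth xs_def ys_def)
  moreover have "(\<lambda>c. fps_flip (es c)) = es" by (simp add: es_def fun_eq_iff)
  ultimately show ?thesis using ring_hm_ev1_arg[OF ring_hm_es ring_hm_fps_flip, of xs G] by simp
qed

lemma flip_gp: "fps_flip (gp G) = gp G"
  and flip_gm: "fps_flip (gm G) = gm G"
proof -
  have *: "ev1 es ys G $ k = (-1) ^ k * ev1 es xs G $ k" for k
    using flip_ev1[of G] fps_flip_nth by metis
  show "fps_flip (gp G) = gp G"
  proof (rule fps_ext)
    show "fps_flip (gp G) $ k = gp G $ k" for k
      by (cases "even k") (simp_all add: fps_flip_nth gp_def *)
  qed
  show "fps_flip (gm G) = gm G"
  proof (rule fps_ext)
    show "fps_flip (gm G) $ k = gm G $ k" for k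
      by (cases "even k") (simp_all add: fps_flip_nth gm_def *)
  qed
qed

lemma A0_0: "A0 $ 0 = g (G1 * pderiv G2 - G2 * pderiv G1) z" "A0 $ 0 \<noteq> 0"
proof -
  show 1: "A0 $ 0 = g (G1 * pderiv G2 - G2 * pderiv G1) z"
    by (simp add: A0_def gp_gm_0 g_arith)
  show "A0 $ 0 \<noteq> 0" unfolding 1 by (rule g_nz) (use minor_nz in \<open>auto simp: algebra_simps\<close>)
qed

lemma as_bs_mult:
  "A0 * as = gp G2 * gm G0 - gp G0 * gm G2" "A0 * bs = gp G0 * gm G1 - gp G1 * gm G0"
  using inverse_mult_eq_1'[OF A0_0(2)] by (simp_all add: as_def bs_def mult.left_commute)

lemma flip_as: "fps_flip as = as" and flip_bs: "fps_flip bs = bs"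
proof -
  have "fps_flip A0 = A0" by (simp add: A0_def ring_hmD[OF ring_hm_fps_flip] flip_gp flip_gm)
  then have "fps_flip (inverse A0) = inverse A0" using fps_flip_inverse A0_0(2) by blast
  then show "fps_flip as = as" "fps_flip bs = bs"
    by (simp_all add: as_def bs_def ring_hmD[OF ring_hm_fps_flip] flip_gp flip_gm)
qed

lemma poly_h: "poly h w = ev1 es w G0 + as * ev1 es w G1 + bs * ev1 es w G2"
  by (simp add: h_def ev1_def)

lemma h_xs_ys: "poly h xs = 0" "poly h ys = 0"
proof -
  have A0: "A0 \<noteq> 0" using A0_0(2) by auto
  \<comment> \<open>(1, \<open>as\<close>, \<open>bs\<close>) times \<open>A0\<close> is the cross
    product of the vectors \<open>gp\<close> and \<open>gm\<close>, hence orthogonal to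
    both.\<close>
  have "A0 * (gp G0 + as * gp G1 + bs * gp G2) = A0 * gp G0 + (A0 * as) * gp G1 + (A0 * bs) * gp G2"
    by (simp add: algebra_simps)
  also have "\<dots> = 0" unfolding as_bs_mult by (simp add: A0_def algebra_simps)
  finally have p: "gp G0 + as * gp G1 + bs * gp G2 = 0" using A0 by simp
  have "A0 * (gm G0 + as * gm G1 + bs * gm G2) = A0 * gm G0 + (A0 * as) * gm G1 + (A0 * bs) * gm G2"
    by (simp add: algebra_simps)
  also have "\<dots> = 0" unfolding as_bs_mult by (simp add: A0_def algebra_simps)
  finally have m: "gm G0 + as * gm G1 + bs * gm G2 = 0" using A0 by simp
  have "poly h xs = (gp G0 + as * gp G1 + bs * gp G2) + fps_X * (gm G0 + as * gm G1 + bs * gm G2)"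
    "poly h ys = (gp G0 + as * gp G1 + bs * gp G2) - fps_X * (gm G0 + as * gm G1 + bs * gm G2)"
    by (simp_all add: poly_h ev1_xs_eq algebra_simps)
  then show "poly h xs = 0" "poly h ys = 0" using p m by simp_all
qed

lemma flip_h: "map_poly fps_flip h = h"
  by (rule poly_eqI)
    (simp add: coeff_map_poly h_def ring_hmD[OF ring_hm_fps_flip] ring_hmD[OF ring_hm_es] flip_as flip_bs,
     simp add: es_def)

lemma hbar_eq: "hbar = map_poly emb G0 + smult (as $ 0) (map_poly emb G1) + smult (bs $ 0) (map_poly emb G2)"
  by (rule poly_eqI)
    (simp add: hbar_def coeff_map_poly h_def const_term_def es_def ring_hmD[OF ring_hm_es] ring_hmD[OF ring_hm_emb])

lemma poly_hbar: "poly hbar w = g G0 w + as $ 0 * g G1 w + bs $ 0 * g G2 w"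
  "poly (pderiv hbar) w = g (pderiv G0) w + as $ 0 * g (pderiv G1) w + bs $ 0 * g (pderiv G2) w"
  "poly (pderiv (pderiv hbar)) w = g (pderiv (pderiv G0)) w + as $ 0 * g (pderiv (pderiv G1)) w
     + bs $ 0 * g (pderiv (pderiv G2)) w"
  by (simp_all add: hbar_eq ev1_def pderiv_add pderiv_smult map_poly_pderiv_ring_hm[OF ring_hm_emb])

text \<open>Stated for arbitrary R so that it covers \<open>hbar\<close> and its first two
  derivatives: each value is, up to the unit \<open>A0 $ 0\<close>, the product of a vector with
  G(z) x G'(z).\<close>

lemma A0_hbar:
  "A0 $ 0 * (R0 + as $ 0 * R1 + bs $ 0 * R2) =
    R0 * g (G1 * pderiv G2 - G2 * pderiv G1) z + R1 * g (G2 * pderiv G0 - G0 * pderiv G2) z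
       + R2 * g (G0 * pderiv G1 - G1 * pderiv G0) z"
proof -
  have "A0 $ 0 * as $ 0 = g (G2 * pderiv G0 - G0 * pderiv G2) z"
     "A0 $ 0 * bs $ 0 = g (G0 * pderiv G1 - G1 * pderiv G0) z"
    using arg_cong[OF as_bs_mult(1), of "\<lambda>f. f $ 0"] arg_cong[OF as_bs_mult(2), of "\<lambda>f. f $ 0"]
    by (simp_all add: gp_gm_0 g_arith)
  moreover have "A0 $ 0 * (R0 + as $ 0 * R1 + bs $ 0 * R2) = R0 * (A0 $ 0) + R1 * (A0 $ 0 * as $ 0) + R2 * (A0 $ 0 * bs $ 0)"
    by (simp add: algebra_simps)
  ultimately show ?thesis using A0_0(1) by simp
qed

lemma degree_hbar: "Polynomial.degree hbar = n" "hbar \<noteq> 0"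
proof -
  have hb: "Polynomial.coeff hbar n = 1" "i > n \<Longrightarrow> Polynomial.coeff hbar i = 0" for i
    using deg_G0 deg_lt by (simp_all add: hbar_eq coeff_map_poly coeff_eq_0 ring_hmD[OF ring_hm_emb])
  then have "Polynomial.degree hbar \<le> n" by (intro degree_le) auto
  then show "Polynomial.degree hbar = n" "hbar \<noteq> 0"
    using hb(1) le_degree[of hbar n] by auto
qed

lemma hbar_simple:
  assumes "poly hbar r = 0" "r \<noteq> z"
  shows "poly (pderiv hbar) r \<noteq> 0"
proof
  assume d: "poly (pderiv hbar) r = 0"
  show False
    using A0_hbar[of "g G0 r" "g G1 r" "g G2 r"] A0_hbar[of "g (pderiv G0) r" "g (pderiv G1) r" "g (pderiv G2) r"]
      assms d tangent_simple_root[OF assms(2)] by (simp add: poly_hbar)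
qed

text \<open>Up to the factor \<open>A0 $ 0\<close>, these are determinants with rows G, G' and a
  third row G, G' or G'' at z. The first two repeat a row; the last is the Wronskian.\<close>

lemma hbar_double: "poly hbar z = 0" "poly (pderiv hbar) z = 0" "poly (pderiv (pderiv hbar)) z \<noteq> 0"
proof -
  have "A0 $ 0 * poly hbar z = 0" "A0 $ 0 * poly (pderiv hbar) z = 0"
    unfolding poly_hbar A0_hbar by (simp_all add: g_arith algebra_simps)
  then show "poly hbar z = 0" "poly (pderiv hbar) z = 0" using A0_0(2) by auto
  have "A0 $ 0 * poly (pderiv (pderiv hbar)) z \<noteq> 0"
    unfolding poly_hbar A0_hbar using g_nz[OF wronskian_nz] by (simp add: g_arith algebra_simps)
  then show "poly (pderiv (pderiv hbar)) z \<noteq> 0" by auto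
qed

text \<open>hbar = (X - z)^2 q with q(z) nonzero because the second derivative is; the roots of q
  are simple by \<open>hbar_simple\<close>, so there are n - 2 of them.\<close>

lemma card_simple_roots: "card {r. poly hbar r = 0 \<and> r \<noteq> z} = n - 2" "n \<ge> 2"
proof -
  obtain q1 where q1: "hbar = [:- z, 1:] * q1" using hbar_double(1) by (metis dvdE poly_eq_0_iff_dvd)
  have d1: "pderiv hbar = q1 + [:- z, 1:] * pderiv q1"
    unfolding q1 pderiv_mult by (simp add: pderiv_pCons del: mult_pCons_left)
  then have "poly q1 z = 0" using hbar_double(2) by simp
  then obtain q where q: "q1 = [:- z, 1:] * q" by (metis dvdE poly_eq_0_iff_dvd)
  have dq: "pderiv q1 = q + [:- z, 1:] * pderiv q"
    unfolding q pderiv_mult by (simp add: pderiv_pCons del: mult_pCons_left)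
  have hq: "poly hbar r = (r - z)\<^sup>2 * poly q r" for r
    unfolding q1 q by (simp add: power2_eq_square algebra_simps)
  have q1r: "poly q1 r = (r - z) * poly q r" for r
    unfolding q by (simp add: algebra_simps)
  have dq1r: "poly (pderiv q1) r = poly q r + (r - z) * poly (pderiv q) r" for r
    unfolding dq by (simp add: algebra_simps)
  have hq': "poly (pderiv hbar) r = 2 * (r - z) * poly q r + (r - z)\<^sup>2 * poly (pderiv q) r" for r
  proof -
    have "poly (pderiv hbar) r = poly q1 r + (r - z) * poly (pderiv q1) r"
      unfolding d1 by (simp add: algebra_simps)
    then show ?thesis by (simp only: q1r dq1r) (simp add: power2_eq_square algebra_simps)
  qed
  have "poly (pderiv (pderiv hbar)) z = poly (pderiv q1) z + poly (pderiv q1) z"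
    unfolding d1 pderiv_add pderiv_mult by (simp add: pderiv_pCons del: mult_pCons_left)
  then have qz: "poly q z \<noteq> 0" using hbar_double(3) by (simp add: dq)
  have q0: "q \<noteq> 0" using degree_hbar q1 q by auto
  have deg: "n = Polynomial.degree q + 2"
    using degree_hbar q0 unfolding q1 q by (simp add: degree_mult_eq del: mult_pCons_left)
  have "card {r. poly q r = 0} = Polynomial.degree q"
  proof (rule card_roots_alg_closed[OF _ q0])
    fix r assume r: "poly q r = 0"
    then have "r \<noteq> z" using qz by auto
    then show "poly (pderiv q) r \<noteq> 0" using hbar_simple[of r] r by (auto simp: hq hq')
  qed
  moreover have "{r. poly hbar r = 0 \<and> r \<noteq> z} = {r. poly q r = 0}" using qz by (auto simp: hq)
  ultimately show "card {r. poly hbar r = 0 \<and> r \<noteq> z} = n - 2" "n \<ge> 2" using deg by auto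
qed

text \<open>The double root splits into \<open>xs\<close> and \<open>ys\<close>, separated by their
  linear coefficients; every other root is the even lift of a simple root and is recognised by its
  constant term.\<close>

lemma h_roots:
  "\<exists>A. finite A \<and> card A = n \<and> xs \<in> A \<and> ys \<in> A \<and> xs \<noteq> ys \<and> (\<forall>w\<in>A. poly h w = 0)
     \<and> (\<forall>w\<in>A - {xs, ys}. fps_flip w = w)"
proof -
  define S where "S = {r. poly hbar r = 0 \<and> r \<noteq> z}"
  have finS: "finite S" unfolding S_def
    by (rule finite_subset[OF _ poly_roots_finite[OF degree_hbar(2)]]) auto
  have "\<forall>r\<in>S. \<exists>y. poly h y = 0 \<and> y $ 0 = r"
    using fps_root_exists[of h] hbar_simple by (auto simp: S_def hbar_def)
  then obtain Y where Y: "\<And>r. r \<in> S \<Longrightarrow> poly h (Y r) = 0 \<and> Y r $ 0 = r" by metis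
  have flip: "fps_flip (Y r) = Y r" if "r \<in> S" for r
    using fps_flip_root[of h "Y r"] Y[OF that] flip_h hbar_simple[of r] that by (auto simp: S_def hbar_def)
  have inj: "inj_on Y S" using Y by (metis inj_onI)
  have "xs $ 1 - ys $ 1 = 2" by (simp add: xs_def ys_def)
  then have ne: "xs \<noteq> ys" using two_ratfun_closure by (metis diff_self)
  have z0: "xs $ 0 = z" "ys $ 0 = z" by (simp_all add: xs_def ys_def)
  have "Y r $ 0 \<noteq> z" if "r \<in> S" for r using Y[OF that] that by (simp add: S_def)
  with z0 have out: "xs \<notin> Y ` S" "ys \<notin> Y ` S" by (metis imageE)+
  have "card (insert xs (insert ys (Y ` S))) = n"
    using card_simple_roots finS out ne inj by (simp add: card_image S_def)
  then show ?thesis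
    using Y flip h_xs_ys finS ne by (intro exI[of _ "insert xs (insert ys (Y ` S))"]) auto
qed


theorem transposition:
  assumes x: "x \<in> ac_roots f" "y \<in> ac_roots f" "x \<noteq> y"
  shows "\<exists>F \<sigma>. field_hom_on F \<sigma> \<and> ac_roots f \<subseteq> F \<and> (\<forall>c. to_ac c \<in> F \<and> \<sigma> (to_ac c) = to_ac c)
     \<and> (\<forall>r\<in>ac_roots f. \<sigma> r = Transposition.transpose x y r)"
proof -
  note e = ring_hm_emb
  let ?i = "fps_to_fls :: ratfun_closure fps \<Rightarrow> _"
  define e' where "e' c = fls_const (emb c)" for c
  have e'_es: "e' c = ?i (es c)" for c by (simp add: e'_def es_def)
  have e': "ring_hm e'" unfolding e'_es[abs_def] by (rule ring_hm_comp[OF ring_hm_es ring_hm_fps_to_fls])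
  have xs: "?i xs = fls_const z + fls_X" and ys: "?i ys = fls_const z - fls_X"
    by (simp_all add: xs_def ys_def fls_times_fps_to_fls)
  have "indep e' (?i xs) (?i ys)"
    using indep_fls[OF e transc_z] by (simp add: xs ys e'_def[abs_def])
  then obtain F \<phi> where F: "field_hom_on F \<phi>" "x \<in> F" "y \<in> F" "\<phi> x = ?i xs" "\<phi> y = ?i ys"
      "\<And>c. emb c \<in> F \<and> \<phi> (emb c) = e' c"
    using indep_hom[OF e indep_roots[OF x] e'] by blast
  interpret field_hom_on F \<phi> by fact
  have ab: "gen_a \<in> F" "gen_b \<in> F" "range to_ac \<subseteq> F" using gen_mem[of F x y] subfld F x by auto
  have G: "g G t \<in> F" "\<phi> (g G t) = ev1 e' (\<phi> t) G" if "t \<in> F" for G t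
    using hom_ev1[OF F(1) e e' F(6) that] by blast+
  have Gi: "ev1 e' (?i w) G = ?i (ev1 es w G)" for w G
    using ring_hm_ev1_arg[OF ring_hm_es ring_hm_fps_to_fls, of w G] by (simp add: e'_es[abs_def])
  have "\<phi> (g G0 t + gen_a * g G1 t + gen_b * g G2 t)
      = ev1 e' (\<phi> t) G0 + \<phi> gen_a * ev1 e' (\<phi> t) G1 + \<phi> gen_b * ev1 e' (\<phi> t) G2" if "t \<in> F" for t
    using ab G[OF that] by (simp add: hom_add hom_mult F_closed)
  from this[OF F(2)] this[OF F(3)]
  have eqs: "ev1 e' (?i xs) G0 + \<phi> gen_a * ev1 e' (?i xs) G1 + \<phi> gen_b * ev1 e' (?i xs) G2 = 0"
      "ev1 e' (?i ys) G0 + \<phi> gen_a * ev1 e' (?i ys) G1 + \<phi> gen_b * ev1 e' (?i ys) G2 = 0"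
    by (simp_all add: root_eq x F)
  have eqs': "ev1 e' (?i w) G0 + ?i as * ev1 e' (?i w) G1 + ?i bs * ev1 e' (?i w) G2 = ?i (poly h w)" for w
    by (simp add: Gi poly_h fls_times_fps_to_fls)
  have eqs'': "ev1 e' (?i xs) G0 + ?i as * ev1 e' (?i xs) G1 + ?i bs * ev1 e' (?i xs) G2 = 0"
      "ev1 e' (?i ys) G0 + ?i as * ev1 e' (?i ys) G1 + ?i bs * ev1 e' (?i ys) G2 = 0"
    by (simp_all add: eqs' h_xs_ys)
  have "\<phi> (g G1 y * g G2 x - g G1 x * g G2 y) \<noteq> 0"
    using det_nz[OF x] G F by (subst hom_eq_0_iff) (auto simp: F_closed)
  then have "ev1 e' (?i ys) G1 * ev1 e' (?i xs) G2 - ev1 e' (?i xs) G1 * ev1 e' (?i ys) G2 \<noteq> 0"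
    using G F by (simp add: hom_diff hom_mult F_closed)
  \<comment> \<open>The images of a and b, and the series \<open>as\<close> and \<open>bs\<close>,
    solve the same two equations with nonzero determinant.\<close>
  then have phi_ab: "\<phi> gen_a = ?i as" "\<phi> gen_b = ?i bs"
    using linear_system_unique[OF eqs] linear_system_unique[OF eqs''] by simp_all
  define hM where "hM = map_poly ?i h"
  have phi_f: "map_poly \<phi> fhat = hM"
  proof (rule poly_eqI)
    fix k
    have "Polynomial.coeff (map_poly \<phi> fhat) k = \<phi> (emb (Polynomial.coeff G0 k)
       + gen_a * emb (Polynomial.coeff G1 k) + gen_b * emb (Polynomial.coeff G2 k))"
      by (simp add: coeff_map_poly fhat_eq ring_hmD[OF e])
    also have "\<dots> = Polynomial.coeff hM k"
      using F(6) ab by (simp add: hom_add hom_mult F_closed phi_ab hM_def coeff_map_poly h_def e'_es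
          ring_hmD[OF ring_hm_es] fls_times_fps_to_fls)
    finally show "Polynomial.coeff (map_poly \<phi> fhat) k = Polynomial.coeff hM k" .
  qed
  have deg_hM: "Polynomial.degree hM = n" "hM \<noteq> 0"
    using degree_map_poly_hom[OF fhat_over[OF ab(3)]] degree_fhat by (simp_all add: phi_f)
  obtain A where A: "finite A" "card A = n" "xs \<in> A" "ys \<in> A" "xs \<noteq> ys" "\<And>w. w \<in> A \<Longrightarrow> poly h w = 0"
     "\<And>w. w \<in> A - {xs, ys} \<Longrightarrow> fps_flip w = w" using h_roots by blast
  have "?i ` A \<subseteq> {w. poly hM w = 0}"
    using A(6) by (auto simp: hM_def ring_hm_poly_arg[OF ring_hm_fps_to_fls, symmetric])
  moreover have card_A: "card (?i ` A) = n" using A(2) by (subst card_image) (auto intro: inj_onI)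
  ultimately have sub: "?i ` A \<subseteq> {w. poly hM w = 0}" "card (?i ` A) = Polynomial.degree hM"
    using deg_hM by simp_all
  \<comment> \<open>The n explicit roots replace algebraic closedness of K((s)) and let the
    embedding extend to every root of f.\<close>
  then have sp: "splits hM" using deg_hM(2) by (rule splits_card)
  have roots: "{w. poly hM w = 0} = ?i ` A"
    using sub card_poly_roots_bound[OF deg_hM(2)] poly_roots_finite[OF deg_hM(2)]
    by (intro card_seteq[symmetric]) auto
  obtain F' \<psi> where F': "field_hom_on F' \<psi>" "ac_roots f \<union> F \<subseteq> F'" "\<And>t. t \<in> F \<Longrightarrow> \<psi> t = \<phi> t"
    using extend_hom_set[OF finite_ac_roots F(1) fhat_over[OF ab(3)] degree_fhat(2), folded phi_f] sp
    by (auto simp: ac_roots_f phi_f)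
  interpret \<psi>: field_hom_on F' \<psi> by fact
  let ?T = "fls_flip :: ratfun_closure fls \<Rightarrow> _"
  have T: "field_hom_on F' (\<lambda>t. ?T (\<psi> t))"
    by (rule field_hom_on_comp[OF F'(1) ring_hm_imp_field_hom_on[OF ring_hm_fls_flip subfld_UNIV]]) simp
  \<comment> \<open>The subfield of elements whose image is even in s; it contains the constants, a
    and b, hence all of C(a, b).\<close>
  define K where "K = {t \<in> F'. ?T (\<psi> t) = \<psi> t}"
  have "emb c \<in> K" for c
  proof -
    have "?T (?i (es c)) = ?i (es c)" by (simp add: fls_flip_def es_def)
    then show ?thesis using F'(2) F'(3)[of "emb c"] F(6)[of c] by (auto simp: K_def e'_es)
  qed
  moreover have "gen_a \<in> K" "gen_b \<in> K"
    using F'(2) F'(3) ab by (auto simp: K_def phi_ab fls_flip_fps_to_fls flip_as flip_bs)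
  moreover have "subfld K" unfolding K_def by (rule subfld_eq_hom[OF T F'(1)])
  ultimately have "range to_ac \<subseteq> K" by (intro range_to_ac_subset) auto
  then have fixed: "to_ac c \<in> F'" "?T (\<psi> (to_ac c)) = \<psi> (to_ac c)" for c
    by (auto simp: K_def)
  have "fps_flip xs = ys" "fps_flip ys = xs" by (rule fps_ext; auto simp: fps_flip_nth xs_def ys_def)+
  then have flip_xy: "?T (\<psi> x) = \<psi> y" "?T (\<psi> y) = \<psi> x" using F F' by (simp_all add: fls_flip_fps_to_fls)
  have flip_roots: "?T (\<psi> r) = \<psi> (Transposition.transpose x y r)" if r: "r \<in> ac_roots f" for r
  proof (cases "r = x \<or> r = y")
    case True
    then show ?thesis using flip_xy by auto
  next
    case False
    have "map_poly \<psi> fhat = hM"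
      unfolding phi_f[symmetric] using F'(3) ab(3)
      by (intro poly_eqI) (auto simp: coeff_map_poly fhat_def)
    then have "poly hM (\<psi> r) = 0"
      using \<psi>.hom_poly[OF fhat_over, of r] fixed r F'(2) by (auto simp: ac_roots_f)
    then obtain w where w: "w \<in> A" "\<psi> r = ?i w" using roots by auto
    have "\<psi> r \<noteq> \<psi> x" "\<psi> r \<noteq> \<psi> y" using False r x F'(2) by (auto simp: \<psi>.hom_eq_iff subset_iff)
    then have "fps_flip w = w" using A(7) w F F' by auto
    then show ?thesis using w False by (simp add: fls_flip_fps_to_fls)
  qed
  \<comment> \<open>\<open>F'\<close> need not be stable under the flip, so the domain is cut down
    to where \<psi>^-1 o flip o \<psi> makes sense. It still contains C(a, b) and all roots.\<close>
  define L where "L = {t \<in> F'. ?T (\<psi> t) \<in> \<psi> ` F'}"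
  define \<sigma> where "\<sigma> t = inv_into F' \<psi> (?T (\<psi> t))" for t
  have "field_hom_on L (\<lambda>t. ?T (\<psi> t))"
    using field_hom_on.subfld_vimage[OF T \<psi>.subfld_image] by (intro field_hom_on.restrict_hom[OF T]) (auto simp: L_def)
  then have "field_hom_on L \<sigma>" unfolding \<sigma>_def
    by (rule field_hom_on_comp[OF _ \<psi>.inv_hom]) (auto simp: L_def)
  moreover have inv: "inv_into F' \<psi> (\<psi> t) = t" if "t \<in> F'" for t using that \<psi>.inj_hom by simp
  have "Transposition.transpose x y r \<in> ac_roots f" if "r \<in> ac_roots f" for r
    using that x by (auto simp: Transposition.transpose_def)
  then have "r \<in> L \<and> \<sigma> r = Transposition.transpose x y r" if "r \<in> ac_roots f" for r
    using that flip_roots[OF that] F'(2) inv by (auto simp: L_def \<sigma>_def)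
  moreover have "to_ac c \<in> L \<and> \<sigma> (to_ac c) = to_ac c" for c
    using fixed[of c] inv by (auto simp: L_def \<sigma>_def)
  ultimately show ?thesis by (intro exI[of _ L] exI[of _ \<sigma>]) auto
qed

end

section \<open>Galois groups as permutation groups\<close>

lemma ring_of_type_algebra_simps:
  "\<one>\<^bsub>ring_of_type_algebra\<^esub> = (1::'a::field)" "\<zero>\<^bsub>ring_of_type_algebra\<^esub> = (0::'a)"
  "x \<oplus>\<^bsub>ring_of_type_algebra\<^esub> y = (x + y :: 'a)" "x \<otimes>\<^bsub>ring_of_type_algebra\<^esub> y = (x * y :: 'a)"
  "\<ominus>\<^bsub>ring_of_type_algebra\<^esub> x = (- x :: 'a)"
  "x \<noteq> 0 \<Longrightarrow> inv\<^bsub>ring_of_type_algebra\<^esub> x = (inverse x :: 'a)"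
proof -
  show s: "\<one>\<^bsub>ring_of_type_algebra\<^esub> = (1::'a::field)" "\<zero>\<^bsub>ring_of_type_algebra\<^esub> = (0::'a)"
    "x \<oplus>\<^bsub>ring_of_type_algebra\<^esub> y = (x + y :: 'a)" "x \<otimes>\<^bsub>ring_of_type_algebra\<^esub> y = (x * y :: 'a)" for x y
    by (simp_all add: ring_of_type_algebra_def)
  interpret Ring.field "ring_of_type_algebra :: 'a ring" by (rule field_from_type_algebra)
  have c: "carrier (ring_of_type_algebra :: 'a ring) = UNIV" by (simp add: ring_of_type_algebra_def)
  show "\<ominus>\<^bsub>ring_of_type_algebra\<^esub> x = (- x :: 'a)"
    by (rule minus_equality) (simp_all add: s c)
  show "inv\<^bsub>ring_of_type_algebra\<^esub> x = (inverse x :: 'a)" if "x \<noteq> 0"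
    by (rule comm_inv_char) (use that in \<open>simp_all add: s c\<close>)
qed

lemma subfld_generate_field: "subfld (generate_field ring_of_type_algebra H)"
proof -
  let ?G = "generate_field ring_of_type_algebra H"
  have one: "1 \<in> ?G" using generate_field.one[of ring_of_type_algebra H]
    by (simp add: ring_of_type_algebra_simps)
  have neg: "- x \<in> ?G" if "x \<in> ?G" for x using generate_field.a_inv[OF that]
    by (simp add: ring_of_type_algebra_simps)
  have add: "x + y \<in> ?G" if "x \<in> ?G" "y \<in> ?G" for x y using generate_field.eng_add[OF that]
    by (simp add: ring_of_type_algebra_simps)
  have mult: "x * y \<in> ?G" if "x \<in> ?G" "y \<in> ?G" for x y using generate_field.eng_mult[OF that]
    by (simp add: ring_of_type_algebra_simps)
  have zero: "0 \<in> ?G" using add[OF one neg[OF one]] by simp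
  have inv: "inverse x \<in> ?G" if "x \<in> ?G" for x
    using generate_field.m_inv[OF that] zero by (cases "x = 0") (auto simp: ring_of_type_algebra_simps)
  show ?thesis
    unfolding subfld_def
  proof (intro conjI ballI)
    show "1 \<in> ?G" by (rule one)
    fix x y assume xy: "x \<in> ?G" "y \<in> ?G"
    show "x - y \<in> ?G" using add[OF xy(1) neg[OF xy(2)]] by simp
    show "x * y \<in> ?G" using mult[OF xy] .
    show "x / y \<in> ?G" using mult[OF xy(1) inv[OF xy(2)]] by (simp add: divide_inverse)
  qed
qed

lemma generate_field_least:
  assumes "subfld F" "H \<subseteq> F"
  shows "generate_field ring_of_type_algebra H \<subseteq> F"
proof
  fix x assume "x \<in> generate_field ring_of_type_algebra H"
  then show "x \<in> F"
    by induction (use assms in \<open>auto simp: ring_of_type_algebra_simps subfldD\<close>)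
qed

lemma subfld_splitting_field:
  shows "subfld (splitting_field p)" "to_ac c \<in> splitting_field p" "ac_roots p \<subseteq> splitting_field p"
  unfolding splitting_field_def
  by (auto intro: subfld_generate_field generate_field.incl)

lemma splitting_field_least:
  assumes "subfld F" "\<And>c. to_ac c \<in> F" "ac_roots p \<subseteq> F"
  shows "splitting_field p \<subseteq> F"
  unfolding splitting_field_def by (rule generate_field_least) (use assms in auto)

lemma galois_group_carrier:
  "\<sigma> \<in> carrier (galois_group p) \<longleftrightarrow>
     \<sigma> \<in> Bij (splitting_field p) \<and> field_hom_on (splitting_field p) \<sigma> \<and> (\<forall>c. \<sigma> (to_ac c) = to_ac c)"
  (is "?l \<longleftrightarrow> ?r")
proof -
  define L where "L = splitting_field p"
  define R where "R = ring_of_type_algebra\<lparr>carrier := L\<rparr>"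
  have R: "carrier R = L" "\<one>\<^bsub>R\<^esub> = 1" "x \<oplus>\<^bsub>R\<^esub> y = x + y" "x \<otimes>\<^bsub>R\<^esub> y = x * y" for x y
    by (simp_all add: R_def ring_of_type_algebra_def)
  have "\<sigma> \<in> ring_hom R R \<longleftrightarrow> field_hom_on L \<sigma>" if "\<sigma> \<in> Bij L"
    using that Bij_imp_funcset[OF that] subfld_splitting_field(1)[of p]
    by (auto simp: ring_hom_def R field_hom_on_def L_def)
  then show ?thesis
    by (auto simp: galois_group_def Let_def simp flip: L_def R_def)
qed

lemma hom_permutes_roots:
  assumes "p \<noteq> 0" "field_hom_on F \<sigma>" "ac_roots p \<subseteq> F" "\<And>c. to_ac c \<in> F \<and> \<sigma> (to_ac c) = to_ac c"
  shows "bij_betw \<sigma> (ac_roots p) (ac_roots p)"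
proof -
  interpret field_hom_on F \<sigma> by fact
  let ?p = "map_poly to_ac p"
  have p0: "?p \<noteq> 0" using assms(1) by (simp add: map_poly_eq_0_iff)
  have fin: "finite (ac_roots p)" unfolding ac_roots_def by (rule poly_roots_finite) fact
  have over: "?p \<in> polys_over F" using assms(4) by (auto simp: polys_over_def coeff_map_poly)
  have map: "map_poly \<sigma> ?p = ?p" using assms(4) by (auto intro!: poly_eqI simp: coeff_map_poly)
  have "\<sigma> ` ac_roots p \<subseteq> ac_roots p"
  proof safe
    fix x assume x: "x \<in> ac_roots p"
    then have "poly (map_poly \<sigma> ?p) (\<sigma> x) = 0"
      using hom_poly[OF over, of x] assms(3) by (auto simp: ac_roots_def)
    then show "\<sigma> x \<in> ac_roots p" by (simp add: map ac_roots_def)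
  qed
  moreover have "inj_on \<sigma> (ac_roots p)" using inj_hom assms(3) inj_on_subset by blast
  ultimately show ?thesis using fin by (simp add: bij_betw_def endo_inj_surj)
qed

text \<open>Since the roots are permuted, the preimage and the image of the splitting field are
  subfields containing all its generators; minimality makes the restriction a bijection.\<close>

lemma hom_induces_galois:
  assumes "p \<noteq> 0" "field_hom_on F \<sigma>" "ac_roots p \<subseteq> F" "\<And>c. to_ac c \<in> F \<and> \<sigma> (to_ac c) = to_ac c"
  shows "restrict \<sigma> (splitting_field p) \<in> carrier (galois_group p)"
proof -
  define L where "L = splitting_field p"
  note L = subfld_splitting_field[where p = p, folded L_def]
  interpret field_hom_on F \<sigma> by fact
  have LF: "L \<subseteq> F" unfolding L_def using subfld assms by (intro splitting_field_least) auto
  have hom: "field_hom_on L \<sigma>" by (rule restrict_hom) fact+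
  note bij = hom_permutes_roots[OF assms]
  have "L \<subseteq> {x \<in> F. \<sigma> x \<in> L}" unfolding L_def
    using subfld_vimage L assms bij by (intro splitting_field_least) (auto simp: L_def bij_betw_def)
  moreover have "L \<subseteq> \<sigma> ` L"
  proof -
    have "to_ac c \<in> \<sigma> ` L" for c using L(2) assms(4) by (metis imageI)
    moreover have "ac_roots p \<subseteq> \<sigma> ` L"
      using bij image_mono[OF L(3), of \<sigma>] by (simp add: bij_betw_def)
    ultimately show ?thesis
      using splitting_field_least[OF field_hom_on.subfld_image[OF hom]] by (auto simp: L_def)
  qed
  ultimately have "bij_betw \<sigma> L L"
    using inj_hom LF inj_on_subset by (auto simp: bij_betw_def)
  then have "restrict \<sigma> L \<in> Bij L" by (auto simp: Bij_def)
  moreover have "field_hom_on L (restrict \<sigma> L)" by (rule field_hom_on_cong[OF hom]) simp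
  ultimately show ?thesis using L(2) assms(4) by (simp add: galois_group_carrier flip: L_def)
qed

theorem root_action_iso:
  assumes p: "p \<noteq> 0"
    and swap: "\<And>x y. x \<in> ac_roots p \<Longrightarrow> y \<in> ac_roots p \<Longrightarrow> x \<noteq> y \<Longrightarrow>
      \<exists>F \<sigma>. field_hom_on F \<sigma> \<and> ac_roots p \<subseteq> F \<and> (\<forall>c. to_ac c \<in> F \<and> \<sigma> (to_ac c) = to_ac c)
        \<and> (\<forall>r\<in>ac_roots p. \<sigma> r = Transposition.transpose x y r)"
  shows "root_action p \<in> iso (galois_group p) (BijGroup (ac_roots p))"
proof -
  define L where "L = splitting_field p"
  define R where "R = ac_roots p"
  note L = subfld_splitting_field[where p = p, folded L_def R_def]
  note G = galois_group_carrier[of _ p, folded L_def]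
  have fin: "finite R" unfolding R_def ac_roots_def
    using p by (intro poly_roots_finite) (simp add: map_poly_eq_0_iff)
  have bij: "bij_betw \<sigma> R R" if "\<sigma> \<in> carrier (galois_group p)" for \<sigma>
    using hom_permutes_roots[OF p, of L \<sigma>] that L G by (auto simp: R_def)
  \<comment> \<open>Permutations of a finite set are built up from the identity by transpositions,
    each induced by some homomorphism; these are composed.\<close>
  have real: "\<exists>\<sigma>\<in>carrier (galois_group p). \<forall>r\<in>R. \<sigma> r = \<pi> r" if "\<pi> permutes R" for \<pi>
    using that fin
  proof (induction rule: permutes_induct)
    case id
    have "restrict (\<lambda>x. x) L \<in> carrier (galois_group p)"
      using hom_induces_galois[OF p field_hom_on_id[OF L(1)]] L by (auto simp: L_def R_def)
    then show ?case using L(3) by (intro bexI) auto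
  next
    case (swap x y \<pi>)
    then obtain \<sigma> where \<sigma>: "\<sigma> \<in> carrier (galois_group p)" "\<forall>r\<in>R. \<sigma> r = \<pi> r" by blast
    show ?case
    proof (cases "x = y")
      case True
      then show ?thesis using \<sigma> by (intro bexI[of _ \<sigma>]) auto
    next
      case False
      then obtain F \<tau> where \<tau>: "field_hom_on F \<tau>" "R \<subseteq> F" "\<And>c. to_ac c \<in> F \<and> \<tau> (to_ac c) = to_ac c"
        "\<And>r. r \<in> R \<Longrightarrow> \<tau> r = Transposition.transpose x y r"
        using assms(2)[of x y] swap.hyps by (auto simp: R_def)
      have "L \<subseteq> F" unfolding L_def
        by (rule splitting_field_least[OF field_hom_on.subfld[OF \<tau>(1)]]) (use \<tau> in \<open>auto simp: R_def\<close>)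
      moreover have "\<sigma> ` L \<subseteq> L" using \<sigma>(1) G by (auto simp: Bij_def bij_betw_def)
      ultimately have "field_hom_on L (\<lambda>x. \<tau> (\<sigma> x))"
        using G \<sigma>(1) \<tau>(1) by (intro field_hom_on_comp[of L \<sigma> F \<tau>]) auto
      then have "restrict (\<lambda>x. \<tau> (\<sigma> x)) L \<in> carrier (galois_group p)"
        using hom_induces_galois[OF p] L \<tau>(3) \<sigma>(1) G by (auto simp: L_def R_def)
      moreover have "\<pi> r \<in> R" if "r \<in> R" for r using \<sigma> bij that by (metis bij_betw_apply)
      ultimately show ?thesis
        using L(3) \<sigma>(2) \<tau>(4) by (intro bexI[of _ "restrict (\<lambda>x. \<tau> (\<sigma> x)) L"]) auto
    qed
  qed
  show ?thesis
    unfolding iso_def hom_def bij_betw_def mem_Collect_eq Int_iff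
  proof (intro conjI ballI)
    have act: "root_action p \<sigma> \<in> Bij R" if "\<sigma> \<in> carrier (galois_group p)" for \<sigma>
      using bij[OF that] by (auto simp: root_action_def Bij_def R_def)
    then show "root_action p \<in> carrier (galois_group p) \<rightarrow> carrier (BijGroup (ac_roots p))"
      by (auto simp: BijGroup_def R_def)
    show "root_action p (\<sigma> \<otimes>\<^bsub>galois_group p\<^esub> \<tau>) =
        root_action p \<sigma> \<otimes>\<^bsub>BijGroup (ac_roots p)\<^esub> root_action p \<tau>"
      if st: "\<sigma> \<in> carrier (galois_group p)" "\<tau> \<in> carrier (galois_group p)" for \<sigma> \<tau>
    proof -
      have "\<sigma> \<otimes>\<^bsub>galois_group p\<^esub> \<tau> = compose L \<sigma> \<tau>"
        using st by (simp add: galois_group_def Let_def BijGroup_def L_def)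
      moreover have "root_action p \<sigma> \<otimes>\<^bsub>BijGroup (ac_roots p)\<^esub> root_action p \<tau> =
          compose R (root_action p \<sigma>) (root_action p \<tau>)"
        using act[OF st(1)] act[OF st(2)] by (simp add: BijGroup_def R_def)
      moreover have "\<tau> r \<in> R" if "r \<in> R" for r using bij[OF st(2)] that by (metis bij_betw_apply)
      ultimately show ?thesis
        using L(3) by (auto simp: root_action_def compose_def fun_eq_iff R_def[symmetric])
    qed
    show "inj_on (root_action p) (carrier (galois_group p))"
    proof (rule inj_onI)
      fix \<sigma> \<tau> assume st: "\<sigma> \<in> carrier (galois_group p)" "\<tau> \<in> carrier (galois_group p)"
        and eq: "root_action p \<sigma> = root_action p \<tau>"
      have "\<sigma> r = \<tau> r" if "r \<in> R" for r
        using fun_cong[OF eq, of r] that by (simp add: root_action_def R_def)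
      then have "L \<subseteq> {x \<in> L. \<sigma> x = \<tau> x}"
        unfolding L_def using st G L subfld_eq_hom[of L \<sigma> \<tau>]
        by (intro splitting_field_least) (auto simp: L_def R_def)
      then show "\<sigma> = \<tau>"
        using st G by (intro extensionalityI[of _ L]) (auto simp: Bij_def)
    qed
    show "root_action p ` carrier (galois_group p) = carrier (BijGroup (ac_roots p))"
    proof (intro equalityI subsetI)
      fix \<pi> assume "\<pi> \<in> carrier (BijGroup (ac_roots p))"
      then have \<pi>: "\<pi> \<in> extensional R" "bij_betw \<pi> R R" by (auto simp: BijGroup_def Bij_def R_def)
      \<comment> \<open>Elements of \<open>BijGroup\<close> are \<open>undefined\<close> off
        \<open>R\<close>, whereas \<open>permutes\<close> demands the identity there.\<close>
      define \<pi>' where "\<pi>' x = (if x \<in> R then \<pi> x else x)" for x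
      have "bij_betw \<pi>' R R" using \<pi>(2) by (subst bij_betw_cong[of R \<pi>' \<pi>]) (auto simp: \<pi>'_def)
      then have "\<pi>' permutes R" by (rule bij_imp_permutes) (auto simp: \<pi>'_def)
      then obtain \<sigma> where \<sigma>: "\<sigma> \<in> carrier (galois_group p)" "\<forall>r\<in>R. \<sigma> r = \<pi>' r" using real by blast
      have "root_action p \<sigma> = \<pi>"
        using \<sigma>(2) \<pi>(1) by (intro extensionalityI[of _ R]) (auto simp: root_action_def R_def \<pi>'_def)
      then show "\<pi> \<in> root_action p ` carrier (galois_group p)" using \<sigma>(1) by blast
    qed (use act in \<open>auto simp: BijGroup_def R_def\<close>)
  qed
qed

section \<open>The two families\<close>

lemma ev1_pcompose:
  assumes e: "ring_hm e"
  shows "ev1 e u (pcompose p q) = ev1 e (ev1 e u q) p"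
  by (induction p) (auto simp: pcompose_pCons ev1_pCons[OF e] ev1_const[OF e] ring_hmD[OF ring_hm_ev1[OF e]])

lemma coeff_pcompose_linear:
  fixes p :: "'k::comm_ring_1 poly"
  shows "Polynomial.coeff (pcompose p [:b, - 1:]) k =
    (\<Sum>i\<le>Polynomial.degree p. Polynomial.coeff p i * (of_nat (i choose k) * (-1) ^ k * b ^ (i - k)))"
proof -
  have "pcompose p [:b, - 1:] = (\<Sum>i\<le>Polynomial.degree p. smult (Polynomial.coeff p i) ([:b, - 1:] ^ i))"
    using degree_map_poly[of "\<lambda>x. [:x:]" p] by (simp add: pcompose_altdef poly_altdef coeff_map_poly)
  moreover have "Polynomial.coeff ([:b, - 1:] ^ i) k = of_nat (i choose k) * (-1) ^ k * b ^ (i - k)" for i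
  proof (cases "k \<le> i")
    case True
    then show ?thesis by (rule coeff_linear_poly_power)
  next
    case False
    then have "Polynomial.degree ([:b, - 1:] ^ i) < k"
      using degree_power_le[of "[:b, - 1:]" i] by simp
    then show ?thesis using False by (simp add: coeff_eq_0 binomial_eq_0)
  qed
  ultimately show ?thesis by (simp add: coeff_sum)
qed

text \<open>Origin of the inequality in the theorem: G(\<beta> - X) = G(X) determines \<beta>
  through the coefficient of X^(n-1), and the coefficient of X^(n-3) then yields the excluded
  equation.\<close>

lemma reflection_symmetric_coeffs:
  fixes G :: "'k::field_char_0 poly"
  assumes deg: "Polynomial.degree G = n" "Polynomial.lead_coeff G = 1" and n: "n \<ge> 6"
    and sym: "pcompose G [:\<beta>, - 1:] = G"
  shows "- 2 * Polynomial.coeff G (n - 3) =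
         of_nat (n choose 3) * (- (2 * Polynomial.coeff G (n - 1) / of_nat n)) ^ 3
         + of_nat ((n - 1) choose 2) * (- (2 * Polynomial.coeff G (n - 1) / of_nat n)) ^ 2 * Polynomial.coeff G (n - 1)
         + of_nat (n - 2) * (- (2 * Polynomial.coeff G (n - 1) / of_nat n)) * Polynomial.coeff G (n - 2)"
proof -
  define m where "m = n - 3"
  have m: "n = Suc (Suc (Suc m))" using n by (simp add: m_def)
  let ?c = "Polynomial.coeff G"
  have C: "(\<Sum>i\<le>n. ?c i * (of_nat (i choose k) * (-1) ^ k * \<beta> ^ (i - k))) = ?c k" for k
    using coeff_pcompose_linear[of G \<beta> k] by (simp add: sym deg)
  have lead: "?c n = 1" using deg by simp
  have small: "(\<Sum>i\<le>j. ?c i * (of_nat (i choose k) * (-1) ^ k * \<beta> ^ (i - k))) = 0" if "j < k" for j k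
    using that by (intro sum.neutral) auto
  \<comment> \<open>Coefficient of X^n: the symmetry is possible for even n only, which fixes the
    signs below.\<close>
  have even: "(-1) ^ n = (1 :: 'k)"
    using C[of n] small[of "Suc (Suc m)" n] lead by (simp add: m del: sum.atMost_Suc) (simp add: sum.atMost_Suc)
  have odd: "(-1) ^ m = (-1 :: 'k)" using even by (simp add: m minus_equation_iff)
  \<comment> \<open>Coefficient of X^(n-1): -(n \<beta> + a_1) = a_1.\<close>
  have 1: "of_nat n * \<beta> + 2 * ?c (n - 1) = 0"
    using C[of "n - 1"] small[of "Suc m" "n - 1"] odd lead by (simp add: m algebra_simps)
  have \<beta>: "\<beta> = - (2 * ?c (n - 1) / of_nat n)"
  proof -
    have "of_nat n * \<beta> = - 2 * ?c (n - 1)" using 1 by (simp add: add_eq_0_iff2)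
    then show ?thesis using n by (simp add: field_simps)
  qed
  have choose: "Suc m choose m = n - 2" "Suc (Suc m) choose m = (n - 1) choose 2" "Suc (Suc (Suc m)) choose m = n choose 3"
    using binomial_symmetric[of m "Suc m"] binomial_symmetric[of m "Suc (Suc m)"]
      binomial_symmetric[of m "Suc (Suc (Suc m))"] by (simp_all add: m numeral_2_eq_2 numeral_3_eq_3)
  have sm: "(\<Sum>i\<le>m. ?c i * (of_nat (i choose m) * (-1) ^ m * \<beta> ^ (i - m))) = (-1) ^ m * ?c m"
    using small[of "m - 1" m] n m by (cases m) auto
  have half: "- 2 * a = r" if "a = - (a + r)" for a r :: 'k
  proof -
    have "2 * a + r = 0" using that by (simp add: eq_neg_iff_add_eq_0 algebra_simps)
    then have "r = - (2 * a)" by (simp add: add_eq_0_iff)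
    then show ?thesis by simp
  qed
  \<comment> \<open>Coefficient of X^(n-3); the terms come from X^n, X^(n-1) and X^(n-2).\<close>
  have "?c m = - (?c m + (of_nat (n choose 3) * \<beta> ^ 3 + of_nat ((n - 1) choose 2) * \<beta> ^ 2 * ?c (Suc (Suc m))
      + of_nat (n - 2) * \<beta> * ?c (Suc m)))"
    using C[of m] lead
    unfolding m sum.atMost_Suc sm[unfolded odd] choose[unfolded m] odd
    by (simp add: m numeral_2_eq_2 numeral_3_eq_3 algebra_simps del: binomial_Suc_Suc)
  from half[OF this] have "- 2 * ?c (n - 3) = of_nat (n choose 3) * \<beta> ^ 3
      + of_nat ((n - 1) choose 2) * \<beta> ^ 2 * ?c (n - 1) + of_nat (n - 2) * \<beta> * ?c (n - 2)"
    by (simp add: m del: binomial_Suc_Suc)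
  then show ?thesis unfolding \<beta> .
qed

text \<open>For G2 = 1, parallelism gives G1(w) = G1(u), so w = \<beta> - u. Then G(\<beta> - u) =
  G(u) at a transcendental u is a polynomial identity, against \<open>nosym\<close>.\<close>

lemma not_parallel_constant:
  fixes e :: "'k::field_char_0 \<Rightarrow> 'a::field"
  assumes e: "ring_hm e" "transc e u" "w \<noteq> u"
    and nosym: "pcompose G [:\<beta>, - 1:] \<noteq> G"
    and par: "ev1 e w [:0, - \<beta>, 1:] - ev1 e u [:0, - \<beta>, 1:] = 0"
  shows "ev1 e w G - ev1 e u G \<noteq> 0"
proof
  have "(w - u) * (w + u - e \<beta>) = 0"
    using par by (simp add: ev1_pCons e ring_hmD[OF e(1)] algebra_simps)
  then have "w + u - e \<beta> = 0" using e(3) by (simp only: mult_eq_0_iff) simp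
  then have w: "w = e \<beta> - u" by (simp add: algebra_simps)
  assume "ev1 e w G - ev1 e u G = 0"
  then have "ev1 e u (pcompose G [:\<beta>, - 1:] - G) = 0"
    using e(1) by (simp add: ring_hmD[OF ring_hm_ev1] ev1_pcompose ev1_pCons ring_hmD w)
  then have "pcompose G [:\<beta>, - 1:] - G = 0" using e(2) unfolding transc_def by blast
  then show False using nosym by simp
qed

text \<open>Parallelism forces \<open>(u - \<gamma>) (w - \<gamma>) = \<gamma>\<^sup>2 - \<beta>\<close>, and then \<open>u\<close> is a root of a polynomial of degree \<open>2 n - 2\<close>.\<close>
lemma not_parallel_linear:
  fixes e :: "'k::field_char_0 \<Rightarrow> 'a::field"
  assumes e: "ring_hm e" "transc e u" "w \<noteq> u"
    and deg: "Polynomial.degree G = n" "Polynomial.lead_coeff G = 1" "n \<ge> 3"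
    and noroot: "poly G \<gamma> = 0 \<Longrightarrow> \<gamma>\<^sup>2 \<noteq> \<beta>"
    and par: "ev1 e w [:- \<beta>, 0, 1:] * ev1 e u [:- \<gamma>, 1:] - ev1 e u [:- \<beta>, 0, 1:] * ev1 e w [:- \<gamma>, 1:] = 0"
  shows "ev1 e w G * ev1 e u [:- \<gamma>, 1:] - ev1 e u G * ev1 e w [:- \<gamma>, 1:] \<noteq> 0"
proof
  note E = ring_hmD[OF e(1)]
  define U where "U = u - e \<gamma>"
  define W where "W = w - e \<gamma>"
  define \<delta> where "\<delta> = \<gamma>\<^sup>2 - \<beta>"
  define R where "R = pcompose G [:\<gamma>, 1:]"
  have UW: "ev1 e u [:- \<gamma>, 1:] = U" "ev1 e w [:- \<gamma>, 1:] = W"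
    by (simp_all add: ev1_pCons e E U_def W_def)
  have R: "ev1 e u G = ev1 e U R" "ev1 e w G = ev1 e W R"
    by (simp_all add: R_def ev1_pcompose e ev1_pCons E U_def W_def)
  have trU: "Q = 0" if "ev1 e U Q = 0" for Q
  proof -
    have "ev1 e u (pcompose Q [:- \<gamma>, 1:]) = 0" using that by (simp add: ev1_pcompose e UW)
    then have "pcompose Q [:- \<gamma>, 1:] = 0" using e(2) by (simp add: transc_def)
    then show ?thesis by (rule pcompose_eq_0) simp
  qed
  have U0: "U \<noteq> 0"
    using trU[of "[:0, 1:]"] by (auto simp: ev1_pCons e E)
  have "(W - U) * (U * W - e \<delta>) = 0"
    using par unfolding UW
    by (simp add: ev1_pCons e E U_def W_def \<delta>_def algebra_simps power2_eq_square)
  then have UWd: "U * W = e \<delta>" using e(3) by (auto simp: U_def W_def)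
  assume "ev1 e w G * ev1 e u [:- \<gamma>, 1:] - ev1 e u G * ev1 e w [:- \<gamma>, 1:] = 0"
  then have eq: "ev1 e W R * U = ev1 e U R * W" by (simp add: UW R)
  have degR: "Polynomial.degree R = n" "Polynomial.coeff R n = 1"
  proof -
    show d: "Polynomial.degree R = n" by (simp add: R_def degree_pcompose deg)
    have "Polynomial.lead_coeff R = 1" unfolding R_def by (subst lead_coeff_comp) (use deg in auto)
    then show "Polynomial.coeff R n = 1" by (simp add: d)
  qed
  show False
  \<comment> \<open>If \<delta> = 0, then w = \<gamma> and G(\<gamma>) = 0, so \<gamma> is a common
    root; this is what \<open>noroot\<close> forbids.\<close>
  proof (cases "\<delta> = 0")
    case True
    then have "W = 0" using UWd U0 by (simp add: E)
    then have "ev1 e 0 R = 0" using eq U0 by simp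
    moreover have "ev1 e 0 R = e (poly R 0)" by (cases R) (simp_all add: ev1_pCons e E)
    ultimately have "poly R 0 = 0" using e by (simp add: ring_hm_eq_iff)
    then have "poly G \<gamma> = 0" by (simp add: R_def poly_pcompose)
    then show False using noroot True by (simp add: \<delta>_def)
  next
    case False
    \<comment> \<open>S = X^n R(\<delta> / X), so that U^n R(W) = S(U) because U W =
      \<delta>.\<close>
    define S where "S = (\<Sum>i\<le>n. Polynomial.monom (Polynomial.coeff R i * \<delta> ^ i) (n - i))"
    have "ev1 e W R = (\<Sum>i\<le>n. e (Polynomial.coeff R i) * W ^ i)"
    proof -
      interpret field_hom_on UNIV e by (rule ring_hm_imp_field_hom_on) (use e in auto)
      show ?thesis unfolding ev1_def poly_altdef using degree_map_poly_hom(1)[of R] degR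
        by (simp add: coeff_map_poly)
    qed
    then have "U ^ n * ev1 e W R = (\<Sum>i\<le>n. U ^ n * (e (Polynomial.coeff R i) * W ^ i))"
      by (simp add: sum_distrib_left)
    also have "\<dots> = (\<Sum>i\<le>n. e (Polynomial.coeff R i) * e \<delta> ^ i * U ^ (n - i))"
    proof (rule sum.cong[OF refl])
      fix i assume "i \<in> {..n}"
      then have "U ^ n = U ^ i * U ^ (n - i)" by (simp flip: power_add)
      then show "U ^ n * (e (Polynomial.coeff R i) * W ^ i) = e (Polynomial.coeff R i) * e \<delta> ^ i * U ^ (n - i)"
        by (simp add: UWd[symmetric] power_mult_distrib)
    qed
    also have "\<dots> = ev1 e U S"
      by (simp add: S_def ring_hmD[OF ring_hm_ev1[OF e(1)]] ev1_monom e E)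
    finally have S: "U ^ n * ev1 e W R = ev1 e U S" .
    have "ev1 e U S * U = U ^ n * (ev1 e W R * U)" by (simp add: S[symmetric] mult.assoc)
    also have "\<dots> = U ^ (n - 2) * (U * W) * ev1 e U R * U"
    proof -
      have "n = Suc (Suc (n - 2))" using deg(3) by simp
      then have "U ^ n = U ^ (n - 2) * U * U" by (metis power_Suc2)
      then show ?thesis by (simp add: eq)
    qed
    finally have "ev1 e U S = U ^ (n - 2) * e \<delta> * ev1 e U R" using U0 by (simp add: UWd)
    then have "ev1 e U (S - Polynomial.monom \<delta> (n - 2) * R) = 0"
      by (simp add: ring_hmD[OF ring_hm_ev1[OF e(1)]] ev1_monom e)
    then have z: "S - Polynomial.monom \<delta> (n - 2) * R = 0" by (rule trU)
    \<comment> \<open>S has degree at most n, less than 2n - 2 since n is at least 3, whereas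
      \<delta> X^(n-2) R has degree 2n - 2 and leading coefficient \<delta>.\<close>
    have "Polynomial.coeff S (n - 2 + n) = 0"
      unfolding S_def coeff_sum using deg(3) by (intro sum.neutral) auto
    moreover have "Polynomial.coeff (Polynomial.monom \<delta> (n - 2) * R) (n - 2 + n) = \<delta>"
      by (simp add: coeff_monom_mult degR)
    ultimately show False using arg_cong[OF z, of "\<lambda>P. Polynomial.coeff P (n - 2 + n)"] False by simp
  qed
qed

text \<open>The Wronskian reduces to G0' G1'' - G0'' G1', whose coefficient of X^(n-1) is -2n(n -
  2).\<close>

lemma minor_wronskian_constant:
  fixes G0 :: "complex poly"
  assumes deg: "Polynomial.degree G0 = n" "Polynomial.lead_coeff G0 = 1" "n \<ge> 3"
    and G: "G1 = [:0, - \<beta>, 1:]" "G2 = 1"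
  shows "pderiv G1 * G2 - G1 * pderiv G2 \<noteq> 0"
    and "G0 * (pderiv G1 * pderiv (pderiv G2) - pderiv (pderiv G1) * pderiv G2)
        + G1 * (pderiv G2 * pderiv (pderiv G0) - pderiv (pderiv G2) * pderiv G0)
        + G2 * (pderiv G0 * pderiv (pderiv G1) - pderiv (pderiv G0) * pderiv G1) \<noteq> 0" (is "?W \<noteq> 0")
proof -
  show "pderiv G1 * G2 - G1 * pderiv G2 \<noteq> 0" by (simp add: G pderiv_pCons)
  define m where "m = n - 3"
  have m: "n = Suc (Suc (Suc m))" using deg(3) by (simp add: m_def)
  have c: "Polynomial.coeff G0 n = 1" "Polynomial.coeff G0 (Suc n) = 0" using deg by (auto intro: coeff_eq_0)
  have W: "?W = [:2:] * pderiv G0 - [:- \<beta>, 2:] * pderiv (pderiv G0)"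
    by (simp add: G pderiv_pCons mult.commute)
  have "Polynomial.coeff ?W (n - 1) = 2 * of_nat n - 2 * (of_nat (n - 1) * of_nat n)"
    unfolding W using c by (simp add: m coeff_pderiv)
  also have "\<dots> = - 2 * of_nat n * of_nat (n - 2)"
    by (simp add: m algebra_simps)
  also have "\<dots> \<noteq> 0"
    using deg(3) by (simp only: mult_eq_0_iff neg_equal_0_iff_equal of_nat_eq_0_iff) simp
  finally show "?W \<noteq> 0" by (metis coeff_0)
qed

text \<open>The coefficient of X^n in the Wronskian is -(n - 1)(n - 2).\<close>

lemma minor_wronskian_linear:
  fixes G0 :: "complex poly"
  assumes deg: "Polynomial.degree G0 = n" "Polynomial.lead_coeff G0 = 1" "n \<ge> 3"
    and G: "G1 = [:- \<beta>, 0, 1:]" "G2 = [:- \<gamma>, 1:]"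
  shows "pderiv G1 * G2 - G1 * pderiv G2 \<noteq> 0"
    and "G0 * (pderiv G1 * pderiv (pderiv G2) - pderiv (pderiv G1) * pderiv G2)
        + G1 * (pderiv G2 * pderiv (pderiv G0) - pderiv (pderiv G2) * pderiv G0)
        + G2 * (pderiv G0 * pderiv (pderiv G1) - pderiv (pderiv G0) * pderiv G1) \<noteq> 0" (is "?W \<noteq> 0")
proof -
  show "pderiv G1 * G2 - G1 * pderiv G2 \<noteq> 0" by (simp add: G pderiv_pCons)
  define m where "m = n - 3"
  have m: "n = Suc (Suc (Suc m))" using deg(3) by (simp add: m_def)
  have c: "Polynomial.coeff G0 n = 1" "Polynomial.coeff G0 (Suc n) = 0" "Polynomial.coeff G0 (Suc (Suc n)) = 0"
    using deg by (auto intro: coeff_eq_0)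
  have W: "?W = [:- 2:] * G0 + [:- \<beta>, 0, 1:] * pderiv (pderiv G0)
      + ([:- 2 * \<gamma>, 2:] * pderiv G0 - [:0, - 2 * \<gamma>, 2:] * pderiv (pderiv G0))"
  proof -
    have d: "pderiv G1 = [:0, 2:]" "pderiv G2 = 1" by (simp_all add: G pderiv_pCons)
    have p: "[:- 2 * \<gamma>, 2:] = G2 * [:2:]" "pCons 0 (G2 * [:2:]) = G2 * [:0, 2:]" by (simp_all add: G)
    have q: "pderiv [:0, 2:] = [:2 :: complex:]" "[:- 2:] = - [:2 :: complex:]" by (simp_all add: pderiv_pCons)
    show ?thesis
      unfolding d p q G(1)[symmetric]
      by (simp add: algebra_simps del: mult_pCons_left mult_pCons_right)
  qed
  have "Polynomial.coeff ?W n = - 2 + of_nat (n - 1) * of_nat n + (2 * of_nat n - 2 * (of_nat (n - 1) * of_nat n))"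
    unfolding W using c by (simp add: m coeff_pderiv)
  also have "\<dots> = - (of_nat (n - 1) * of_nat (n - 2))"
    by (simp add: m algebra_simps)
  also have "\<dots> \<noteq> 0"
    using deg(3) by (simp only: mult_eq_0_iff neg_equal_0_iff_equal of_nat_eq_0_iff) simp
  finally show "?W \<noteq> 0" by (metis coeff_0)
qed

text \<open>The use of irreducibility: a common root would be a root of every member, so f would
  have a constant root and a linear factor.\<close>

lemma family2_no_common_root:
  fixes G0 G1 G2 :: "'k::field poly"
  assumes irr: "Factorial_Ring.irreducible (family2 G0 G1 G2)"
    and deg: "Polynomial.degree G0 = n" "Polynomial.lead_coeff G0 = 1" "n \<ge> 2"
      "Polynomial.degree G1 < n" "Polynomial.degree G2 < n"
    and root: "poly G0 c = 0" "poly G1 c = 0" "poly G2 c = 0"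
  shows False
proof -
  have hm: "ring_hm (ratfun2_const :: 'k \<Rightarrow> _)"
    by (simp add: ring_hm_def ratfun2_const_def one_pCons[symmetric] flip: to_fract_add to_fract_mult)
  have p: "poly (map_poly ratfun2_const G) (ratfun2_const c) = ratfun2_const (poly G c)" for G :: "'k poly"
    using hm by (induction G) (auto simp: map_poly_pCons ring_hmD)
  have "poly (family2 G0 G1 G2) (ratfun2_const c) = 0"
    using root by (simp add: family2_def p ring_hmD[OF hm])
  then obtain q where q: "family2 G0 G1 G2 = [:- ratfun2_const c, 1:] * q"
    by (metis dvdE poly_eq_0_iff_dvd)
  have "Polynomial.coeff (family2 G0 G1 G2) n = 1"
    using deg by (simp add: family2_def coeff_map_poly coeff_eq_0 ring_hmD[OF hm])
  then have "Polynomial.degree (family2 G0 G1 G2) \<ge> 2"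
    using le_degree[of "family2 G0 G1 G2" n] deg(3) by auto
  moreover have "[:- ratfun2_const c, 1:] dvd 1 \<or> q dvd 1"
    using irr q unfolding Factorial_Ring.irreducible_def by blast
  moreover have "\<not> [:- ratfun2_const c, 1:] dvd 1" by (simp add: is_unit_iff_degree)
  ultimately show False
    using degree_mult_le[of "[:- ratfun2_const c, 1:]" q] unfolding q[symmetric]
    by (cases "q = 0") (auto simp: is_unit_iff_degree)
qed

text \<open>The first conjunct says that the roots are n distinct elements, so that the group of all
  bijections in the second one really is S_n.\<close>

theorem mainTheorem10:
  fixes n :: nat and \<alpha> \<beta> \<gamma> :: rat and c :: "nat \<Rightarrow> int"
    and G0 G1 G2 :: "rat poly"
    and f :: "complex ratfun2 poly"
  assumes n: "n \<ge> 6"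
    and nonsym:
      "- 2 * rat_of_int (c 3) \<noteq>
         rat_of_nat (n choose 3) * (- (2 * rat_of_int (c 1) / rat_of_nat n)) ^ 3
         + rat_of_nat ((n - 1) choose 2) * (- (2 * rat_of_int (c 1) / rat_of_nat n)) ^ 2
             * rat_of_int (c 1)
         + rat_of_nat (n - 2) * (- (2 * rat_of_int (c 1) / rat_of_nat n)) * rat_of_int (c 2)"
    and G:
      "(G0 = Polynomial.monom 1 n
               + (\<Sum>i = 1..n - 3. Polynomial.monom (rat_of_int (c i)) (n - i)) - [:\<alpha>:]
          \<and> G1 = [:- \<beta>, 0, 1:] \<and> G2 = [:- \<gamma>, 1:])
       \<or> (G0 = Polynomial.monom 1 n
               + (\<Sum>i = 1..n - 3. Polynomial.monom (rat_of_int (c i)) (n - i)) - [:0, \<alpha>:]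
          \<and> G1 = [:0, - \<beta>, 1:] \<and> G2 = 1)"
    and irr: "Factorial_Ring.irreducible (family2 G0 G1 G2 :: rat ratfun2 poly)"
    and f: "f = family2 (map_poly of_rat G0) (map_poly of_rat G1) (map_poly of_rat G2)"
  shows "card (ac_roots f) = n
         \<and> root_action f \<in> iso (galois_group f) (BijGroup (ac_roots f))"
proof -
  define core where "core = Polynomial.monom 1 n
               + (\<Sum>i = 1..n - 3. Polynomial.monom (rat_of_int (c i)) (n - i))"
  have core: "Polynomial.coeff core k = (if k = n then 1 else if 3 \<le> k \<and> k < n then rat_of_int (c (n - k)) else 0)" for k
  proof -
    have "(\<Sum>i = 1..n - 3. Polynomial.coeff (Polynomial.monom (rat_of_int (c i)) (n - i)) k)
        = (\<Sum>i = 1..n - 3. if i = n - k then (if k < n then rat_of_int (c i) else 0) else 0)"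
      by (rule sum.cong) auto
    then show ?thesis using n by (auto simp: core_def coeff_sum)
  qed
  \<comment> \<open>The two families differ in the coefficients of degree 0 and 1 alone.\<close>
  have G0k: "Polynomial.coeff G0 k = Polynomial.coeff core k" if "k \<ge> 2" for k
  proof -
    obtain j where j: "k = Suc (Suc j)" using \<open>k \<ge> 2\<close> by (metis add_2_eq_Suc le_Suc_ex)
    have "G0 = core - [:\<alpha>:] \<or> G0 = core - [:0, \<alpha>:]" using G unfolding core_def by blast
    then show ?thesis by (auto simp: j)
  qed
  have degG0: "Polynomial.degree G0 = n" "Polynomial.lead_coeff G0 = 1"
  proof -
    have "Polynomial.degree G0 \<le> n" using n by (intro degree_le) (auto simp: G0k core)
    moreover have "Polynomial.coeff G0 n = 1" using n by (simp add: G0k core)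
    ultimately show "Polynomial.degree G0 = n" using le_degree[of G0 n] by simp
    then show "Polynomial.lead_coeff G0 = 1" using \<open>Polynomial.coeff G0 n = 1\<close> by simp
  qed
  have G0c: "Polynomial.coeff G0 (n - 1) = rat_of_int (c 1)" "Polynomial.coeff G0 (n - 2) = rat_of_int (c 2)"
    "Polynomial.coeff G0 (n - 3) = rat_of_int (c 3)"
    using n by (simp_all add: G0k core) arith+
  have nosym: "pcompose G0 [:\<beta>, - 1:] \<noteq> G0"
    using reflection_symmetric_coeffs[OF degG0 n, of \<beta>] nonsym unfolding G0c by blast
  have degG12: "Polynomial.degree G1 < n" "Polynomial.degree G2 < n" using G n by auto
  have noroot: "\<not> (poly G0 r = 0 \<and> poly G1 r = 0 \<and> poly G2 r = 0)" for r
    using family2_no_common_root[OF irr degG0 _ degG12, of r] n by auto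
  let ?r = "map_poly (of_rat :: rat \<Rightarrow> complex)"
  have hr: "ring_hm (of_rat :: rat \<Rightarrow> complex)" by (simp add: ring_hm_def of_rat_add of_rat_mult)
  interpret r: field_hom_on UNIV "of_rat :: rat \<Rightarrow> complex"
    by (rule ring_hm_imp_field_hom_on[OF hr]) simp
  \<comment> \<open>The parallelism lemmas are applied over the rationals, where the inequality and
    irreducibility are given; transcendence over the complex numbers implies it over the
    rationals.\<close>
  define e where "e q = emb (of_rat q)" for q
  have e: "ring_hm e" unfolding e_def[abs_def] by (rule ring_hm_comp[OF hr ring_hm_emb])
  have ev: "ev1 emb u (?r p) = ev1 e u p" for u p
    by (simp add: ev1_def map_poly_map_poly ring_hmD[OF ring_hm_emb] o_def e_def[abs_def])
  have tr: "transc e u" if "transc emb u" for u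
    using that r.degree_map_poly_hom(2) by (auto simp: transc_def simp flip: ev)
  have degr: "Polynomial.degree (?r p) = Polynomial.degree p" for p
    by (rule r.degree_map_poly_hom) simp
  have lead: "Polynomial.lead_coeff (?r G0) = 1" using degG0 by (simp add: degr coeff_map_poly)
  have n3: "n \<ge> 3" using n by simp
  have deg: "Polynomial.degree (?r G0) = n" by (simp add: degr degG0)
  interpret P: generic_pencil "?r G0" "?r G1" "?r G2" n
  proof
    show "Polynomial.degree (?r G0) = n" by fact
    show "Polynomial.lead_coeff (?r G0) = 1" by fact
    show "Polynomial.degree (?r G1) < n" "Polynomial.degree (?r G2) < n"
      using degG12 by (simp_all add: degr)
    show "poly (?r G2) x \<noteq> 0" if "poly (?r G0) x = 0" "poly (?r G1) x = 0" for x
    proof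
      assume x: "poly (?r G2) x = 0"
      \<comment> \<open>G2 = 1 has no root. In the other family a common complex root must be the
        rational \<gamma>, so irreducibility over Q(a, b) suffices.\<close>
      then have lin: "G2 = [:- \<gamma>, 1:]" using G by auto
      then have "x = of_rat \<gamma>" using x by (simp add: map_poly_pCons of_rat_minus)
      then have "poly G0 \<gamma> = 0" "poly G1 \<gamma> = 0" using that by (simp_all flip: r.hom_poly)
      then show False using noroot lin by auto
    qed
    show "ev1 emb w (?r G0) * ev1 emb u (?r G2) - ev1 emb u (?r G0) * ev1 emb w (?r G2) \<noteq> 0"
      if "transc emb u" "w \<noteq> u" "ev1 emb w (?r G1) * ev1 emb u (?r G2) - ev1 emb u (?r G1) * ev1 emb w (?r G2) = 0"
      for u w
      using G
    proof (elim disjE conjE)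
      assume g: "G1 = [:- \<beta>, 0, 1:]" "G2 = [:- \<gamma>, 1:]"
      have "\<gamma>\<^sup>2 \<noteq> \<beta>" if "poly G0 \<gamma> = 0"
        using noroot[of \<gamma>] that by (auto simp: g power2_eq_square)
      then show ?thesis
        unfolding ev g(2)
        by (intro not_parallel_linear[OF e tr[OF that(1)] that(2) degG0 n3, of \<gamma> \<beta>])
          (use that(3) in \<open>auto simp: ev g\<close>)
    next
      assume g: "G1 = [:0, - \<beta>, 1:]" "G2 = 1"
      have 1: "ev1 emb u 1 = 1" for u by (rule ring_hmD(1)[OF ring_hm_ev1[OF ring_hm_emb]])
      show ?thesis
        using not_parallel_constant[OF e tr[OF that(1)] that(2) nosym] that(3)
        by (simp add: ev g 1)
    qed
    have GG: "?r G1 = [:- of_rat \<beta>, 0, 1:] \<and> ?r G2 = [:- of_rat \<gamma>, 1:] \<or> ?r G1 = [:0, - of_rat \<beta>, 1:] \<and> ?r G2 = 1"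
      using G by (auto simp: map_poly_pCons of_rat_minus r.map_poly_hom)
    show "pderiv (?r G1) * ?r G2 - ?r G1 * pderiv (?r G2) \<noteq> 0"
      using GG
      by (elim disjE conjE)
        (rule minor_wronskian_linear(1)[OF deg lead n3] minor_wronskian_constant(1)[OF deg lead n3];
          assumption)+
    show "?r G0 * (pderiv (?r G1) * pderiv (pderiv (?r G2)) - pderiv (pderiv (?r G1)) * pderiv (?r G2))
        + ?r G1 * (pderiv (?r G2) * pderiv (pderiv (?r G0)) - pderiv (pderiv (?r G2)) * pderiv (?r G0))
        + ?r G2 * (pderiv (?r G0) * pderiv (pderiv (?r G1)) - pderiv (pderiv (?r G0)) * pderiv (?r G1)) \<noteq> 0"
      using GG
      by (elim disjE conjE)
        (rule minor_wronskian_linear(2)[OF deg lead n3] minor_wronskian_constant(2)[OF deg lead n3];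
          assumption)+
  qed
  have f_eq: "f = P.f" by (simp add: f P.f_def)
  have "P.f \<noteq> 0" using P.degree_fhat(2) by (auto simp: P.fhat_def)
  then have "root_action f \<in> iso (galois_group f) (BijGroup (ac_roots f))"
    unfolding f_eq by (rule root_action_iso) (rule P.transposition)
  then show ?thesis using P.card_ac_roots by (simp add: f_eq)
qed

end
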